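(* In the projection-structure setting described in the context (observation $Y=\theta+\sigma\xi$, structures $\mathcal I$, projections $\mathrm P_I$, data dependent measure $\hat\pi(\vartheta|Y)$, estimator $\hat\theta$, radius $\hat r^2$, oracle rate $r^2(\theta)$), assume: (A1) for some $\alpha\in(0,1]$ and nonnegative $(d_I)_{I\in\mathcal I}$, $\ \sup_{\theta\in\Theta}\log\mathbb E_\theta\exp\{\alpha\|\mathrm P_I\xi\|^2\}\le d_I$ for all $I\in\mathcal I$; (A2) for some $\nu,C_\nu>0$, $\ \sum_{I\in\mathcal I}e^{-\nu\rho(I)}\le C_\nu$, and $\rho(I)\ge d_I$ for all $I\in\mathcal I$. Then there exist constants $M_0,M_1,M_3,H_0,H_1,H_3,m_0,m_1,m_3>0$ such that the following holds. Let $\{\Theta_\beta,\beta\in\mathcal B\}$ be a family of subsets of $\Theta$ with minimax rates $r^2(\Theta_\beta)=\inf_{\tilde\theta'}\sup_{\theta\in\Theta_\beta}\mathbb E_\theta\|\tilde\theta'-\theta\|^2$ (infimum over all estimators $\tilde\theta'=\tilde\theta'(Y)$), and suppose that for some $c>0$ $$r^2(\Theta_\beta)\ge c\,r^2(\theta)\quad\text{for all }\theta\in\Theta_\beta,\ \beta\in\mathcal B.$$ Then for any $\beta\in\mathcal B$ and $M\ge0$, $$\sup_{\theta\in\Theta_\beta}\mathbb E_\theta\hat\pi\big(\|\vartheta-\theta\|^2\ge M_0c^{-1}r^2(\Theta_\beta)+M\sigma^2|Y\big)\le H_0e^{-m_0M},$$ $$\sup_{\theta\in\Theta_\beta}\mathbb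 P_\theta\big(\|\hat\theta-\theta\|^2\ge M_1c^{-1}r^2(\Theta_\beta)+M\sigma^2\big)\le H_1e^{-m_1M},$$ $$\sup_{\theta\in\Theta_\beta}\mathbb P_\theta\big(\hat r^2\ge M_3c^{-1}r^2(\Theta_\beta)+(M+1)\sigma^2\big)\le H_3e^{-m_3M}.$$
   Context: Setting. $\mathcal Y=\mathbb R^N$ with Euclidean norm $\|\cdot\|$, $\Theta\subseteq\mathcal Y$ (by default $\Theta=\mathcal Y$). For each $\theta\in\Theta$, under $\mathbb P_\theta$ (expectation $\mathbb E_\theta$) one observes $Y=\theta+\sigma\xi$, where $\sigma>0$ is known and $\mathbb E_\theta\xi=0$; the law of $\xi$ is otherwise unspecified and may depend on $\theta$. $\mathcal I$ is a finite or countable set (family of structures); to each $I\in\mathcal I$ is associated a linear subspace $\mathbb L_I\subseteq\mathcal Y$ with orthogonal projection $\mathrm P_I$. $\rho:\mathcal I\to[0,\infty)$ is a function (majorant of the structure complexity). Data dependent measures (DDMs). With $\alpha,\nu$ the constants in (A1), (A2), fix $\varkappa>(32\nu+10+\alpha)/(4\alpha)$ and put $\lambda_I=e^{-\varkappa\rho(I)}$, $$\tilde\pi(I|Y)=\frac{\lambda_I\exp\{-\|Y-\mathrm P_IY\|^2/(2\sigma^2)\}}{\sum_{J\in\mathcal I}\lambda_J\exp\{-\|Y-\mathrm P_JY\|^2/(2\sigma^2)\}},\quad I\in\mathcal I.$$ Let $Z$ be a random vector in $\mathcal Y$ with an arbitrary fixed law $\mathbb P_Z$ having mean zero and satisfying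 $\mathbb E_Z\exp\{\alpha\|\mathrm P_IZ\|^2\}\le e^{d_I}$ for all $I$. For measurable $B$, $\tilde\pi_I(\vartheta\in B|Y)=\mathbb P_Z(\mathrm P_Iy+\sigma\mathrm P_IZ\in B)|_{y=Y}$. Then $\tilde\pi(\vartheta|Y)=\sum_{I}\tilde\pi_I(\vartheta|Y)\tilde\pi(I|Y)$, $\tilde\theta=\sum_I(\mathrm P_IY)\tilde\pi(I|Y)$; $\hat I\in\arg\max_I\tilde\pi(I|Y)=\arg\min_I\{\|Y-\mathrm P_IY\|^2+2\varkappa\sigma^2\rho(I)\}$; $\check\pi(\vartheta|Y)=\tilde\pi_{\hat I}(\vartheta|Y)$, $\check\theta=\mathrm P_{\hat I}Y$. $(\hat\pi(\vartheta|Y),\hat\theta)$ denotes either $(\tilde\pi(\vartheta|Y),\tilde\theta)$ or $(\check\pi(\vartheta|Y),\check\theta)$ (the statement holds for both). The quadratic radius is $\hat r^2=\sigma^2+\sigma^2\rho(\hat I)$. Oracle rate. $r^2(I,\theta)=\|\theta-\mathrm P_I\theta\|^2+\sigma^2\rho(I)$ and $r^2(\theta)=\min_{I\in\mathcal I}r^2(I,\theta)$. *)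

theory Defs
  imports "HOL-Probability.Probability"
begin

definition orth_proj :: "'a::euclidean_space set \<Rightarrow> 'a \<Rightarrow> 'a" where
  "orth_proj S x = (THE p. p \<in> S \<and> (\<forall>s\<in>S. orthogonal (x - p) s))"

text \<open>The description is proper for every linear subspace:\<close>

lemma orth_proj:
  fixes S :: "'a::euclidean_space set"
  assumes "subspace S"
  shows "orth_proj S x \<in> S" and "\<And>s. s \<in> S \<Longrightarrow> orthogonal (x - orth_proj S x) s"
proof -
  obtain y z where yz: "y \<in> span S" "\<And>w. w \<in> span S \<Longrightarrow> orthogonal z w" "x = y + z"
    using orthogonal_subspace_decomp_exists by blast
  have "\<exists>!p. p \<in> S \<and> (\<forall>s\<in>S. orthogonal (x - p) s)"
  proof (rule ex1I)
    show "y \<in> S \<and> (\<forall>s\<in>S. orthogonal (x - y) s)"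
      using yz assms by (metis add_diff_cancel_left' span_eq_iff)
  next
    fix p assume p: "p \<in> S \<and> (\<forall>s\<in>S. orthogonal (x - p) s)"
    have "p - y \<in> S"
      using p yz(1) assms by (metis span_eq_iff subspace_diff)
    then have "orthogonal (x - p) (p - y)" "orthogonal z (p - y)"
      using p yz(2) span_base by blast+
    then have "(p - y) \<bullet> (p - y) = 0"
      unfolding orthogonal_def yz(3) by (simp add: algebra_simps)
    then show "p = y" by simp
  qed
  from theI'[OF this] show "orth_proj S x \<in> S"
    and "\<And>s. s \<in> S \<Longrightarrow> orthogonal (x - orth_proj S x) s"
    unfolding orth_proj_def by blast+
qed

text \<open>
  Throughout, \<open>\<I>\<close> is the index set of the structures, \<open>L i\<close> the subspace attached to
  the structure \<open>i\<close>, \<open>\<rho>\<close> the complexity majorant, \<open>\<kappa>\<close> the penalty constant, \<open>\<xi>\<close> the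
  noise on the sample space and \<open>P \<theta>\<close> the probability measure governing it.
\<close>

definition obs :: "real \<Rightarrow> ('w \<Rightarrow> 'v::real_vector) \<Rightarrow> 'v \<Rightarrow> 'w \<Rightarrow> 'v" where
  "obs \<sigma> \<xi> \<theta> \<omega> = \<theta> + \<sigma> *\<^sub>R \<xi> \<omega>"

definition struct_weight ::
  "('i \<Rightarrow> 'v::euclidean_space set) \<Rightarrow> ('i \<Rightarrow> real) \<Rightarrow> real \<Rightarrow> real \<Rightarrow> 'v \<Rightarrow> 'i \<Rightarrow> real" where
  "struct_weight L \<rho> \<kappa> \<sigma> y i =
     exp (- \<kappa> * \<rho> i) * exp (- (norm (y - orth_proj (L i) y))\<^sup>2 / (2 * \<sigma>\<^sup>2))"

definition struct_post ::
  "'i set \<Rightarrow> ('i \<Rightarrow> 'v::euclidean_space set) \<Rightarrow> ('i \<Rightarrow> real) \<Rightarrow> real \<Rightarrow> real \<Rightarrow> 'v \<Rightarrow> 'i \<Rightarrow> real" where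
  "struct_post \<I> L \<rho> \<kappa> \<sigma> y i =
     struct_weight L \<rho> \<kappa> \<sigma> y i / (\<Sum>\<^sub>\<infinity>j\<in>\<I>. struct_weight L \<rho> \<kappa> \<sigma> y j)"

definition ddm_struct ::
  "('i \<Rightarrow> 'v::euclidean_space set) \<Rightarrow> real \<Rightarrow> 'v measure \<Rightarrow> 'i \<Rightarrow> 'v \<Rightarrow> 'v set \<Rightarrow> real" where
  "ddm_struct L \<sigma> PZ i y B =
     measure PZ {z \<in> space PZ. orth_proj (L i) y + \<sigma> *\<^sub>R orth_proj (L i) z \<in> B}"

definition ddm_mix ::
  "'i set \<Rightarrow> ('i \<Rightarrow> 'v::euclidean_space set) \<Rightarrow> ('i \<Rightarrow> real) \<Rightarrow> real \<Rightarrow> real \<Rightarrow> 'v measure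
    \<Rightarrow> 'v \<Rightarrow> 'v set \<Rightarrow> real" where
  "ddm_mix \<I> L \<rho> \<kappa> \<sigma> PZ y B =
     (\<Sum>\<^sub>\<infinity>i\<in>\<I>. ddm_struct L \<sigma> PZ i y B * struct_post \<I> L \<rho> \<kappa> \<sigma> y i)"

definition est_mix ::
  "'i set \<Rightarrow> ('i \<Rightarrow> 'v::euclidean_space set) \<Rightarrow> ('i \<Rightarrow> real) \<Rightarrow> real \<Rightarrow> real \<Rightarrow> 'v \<Rightarrow> 'v" where
  "est_mix \<I> L \<rho> \<kappa> \<sigma> y =
     (\<Sum>\<^sub>\<infinity>i\<in>\<I>. struct_post \<I> L \<rho> \<kappa> \<sigma> y i *\<^sub>R orth_proj (L i) y)"

text \<open>
  The selected structure is a map \<open>y \<mapsto> Ihat y\<close> on the observation space; the maximiser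
  need not be unique, so it enters as a parameter.
\<close>

definition ddm_sel ::
  "('i \<Rightarrow> 'v::euclidean_space set) \<Rightarrow> real \<Rightarrow> 'v measure \<Rightarrow> ('v \<Rightarrow> 'i) \<Rightarrow> 'v \<Rightarrow> 'v set \<Rightarrow> real" where
  "ddm_sel L \<sigma> PZ Ihat y B = ddm_struct L \<sigma> PZ (Ihat y) y B"

definition est_sel ::
  "('i \<Rightarrow> 'v::euclidean_space set) \<Rightarrow> ('v \<Rightarrow> 'i) \<Rightarrow> 'v \<Rightarrow> 'v" where
  "est_sel L Ihat y = orth_proj (L (Ihat y)) y"

definition sq_radius :: "('i \<Rightarrow> real) \<Rightarrow> real \<Rightarrow> ('v \<Rightarrow> 'i) \<Rightarrow> 'v \<Rightarrow> real" where
  "sq_radius \<rho> \<sigma> Ihat y = \<sigma>\<^sup>2 + \<sigma>\<^sup>2 * \<rho> (Ihat y)"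

definition struct_rate ::
  "('i \<Rightarrow> 'v::euclidean_space set) \<Rightarrow> ('i \<Rightarrow> real) \<Rightarrow> real \<Rightarrow> 'i \<Rightarrow> 'v \<Rightarrow> real" where
  "struct_rate L \<rho> \<sigma> i \<theta> = (norm (\<theta> - orth_proj (L i) \<theta>))\<^sup>2 + \<sigma>\<^sup>2 * \<rho> i"

text \<open>
  For nonempty \<open>\<I>\<close> and summable \<open>exp (- \<nu> * \<rho> i)\<close>, only finitely many structures have
  complexity below a given bound, so the infimum is a minimum.
\<close>

definition oracle_rate ::
  "'i set \<Rightarrow> ('i \<Rightarrow> 'v::euclidean_space set) \<Rightarrow> ('i \<Rightarrow> real) \<Rightarrow> real \<Rightarrow> 'v \<Rightarrow> real" where
  "oracle_rate \<I> L \<rho> \<sigma> \<theta> = (INF i\<in>\<I>. struct_rate L \<rho> \<sigma> i \<theta>)"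

text \<open>The minimax risk may be infinite, so it is taken in the extended nonnegative reals.\<close>

definition minimax_rate ::
  "('v \<Rightarrow> 'w measure) \<Rightarrow> ('w \<Rightarrow> 'v::euclidean_space) \<Rightarrow> real \<Rightarrow> 'v set \<Rightarrow> ennreal" where
  "minimax_rate P \<xi> \<sigma> T =
     (INF est \<in> borel_measurable borel. SUP \<theta>\<in>T.
        \<integral>\<^sup>+ \<omega>. ennreal ((norm (est (obs \<sigma> \<xi> \<theta> \<omega>) - \<theta>))\<^sup>2) \<partial>P \<theta>)"

end

theory Submission
  imports Defs
begin

text \<open>
  Let \<open>V\<close> be the span of all the spaces \<open>L i\<close>. It has a finite basis inside their union, so
  \<open>\<parallel>P\<^sub>V \<xi>\<parallel>\<close> is at most a constant times the sum of finitely many \<open>\<parallel>P\<^sub>i \<xi>\<parallel>\<close>, and (A1) yields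
  an exponential moment of \<open>X = \<parallel>P\<^sub>V \<xi>\<parallel>\<^sup>2\<close>. The detour through \<open>V\<close> is needed because the cross
  term \<open>\<langle>\<xi>, P\<^sub>i \<theta> - P\<^sub>j \<theta>\<rangle>\<close> in the comparison of two structures is not controlled by
  \<open>\<parallel>P\<^sub>i \<xi>\<parallel>\<close> and \<open>\<parallel>P\<^sub>j \<xi>\<parallel>\<close> when the two spaces enclose a small angle; the price is that the
  constants depend on the geometry of the family.

  The rest is deterministic in \<open>X\<close>. With \<open>r\<^sup>2\<close> the oracle rate and
  \<open>B = 4 \<kappa> r\<^sup>2 + 8 \<sigma>\<^sup>2 X\<close>, the squared bias of the selected structure is at most \<open>B\<close>, and
  the weight of the structure \<open>i\<close> is at most \<open>exp (- \<kappa> \<rho> i - (bias i - B) / (4 \<sigma>\<^sup>2))\<close>, which is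
  summable over \<open>i\<close> even after multiplication by \<open>bias i - B\<close> or by
  \<open>exp (b (bias i - B) / \<sigma>\<^sup>2)\<close> with \<open>b \<le> 1/4\<close>. So every loss is at most a multiple of
  \<open>r\<^sup>2 + \<sigma>\<^sup>2 (1 + X)\<close>, and \<open>r\<^sup>2\<close> is at most the minimax rate divided by \<open>c\<close>.
\<close>

subsection \<open>Orthogonal projections\<close>

lemma orth_proj_eqI:
  assumes "subspace S" "p \<in> S" "\<And>s. s \<in> S \<Longrightarrow> orthogonal (x - p) s"
  shows "orth_proj S x = p"
proof -
  let ?q = "orth_proj S x"
  have "p - ?q \<in> S"
    using assms orth_proj(1) subspace_diff by blast
  then have "orthogonal (x - p) (p - ?q)" "orthogonal (x - ?q) (p - ?q)"
    using assms orth_proj(2) by blast+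
  then have "(p - ?q) \<bullet> (p - ?q) = 0"
    unfolding orthogonal_def by (simp add: algebra_simps)
  then show ?thesis by simp
qed

lemma linear_orth_proj:
  assumes "subspace S"
  shows "linear (orth_proj S)"
proof (rule linearI)
  fix x y
  show "orth_proj S (x + y) = orth_proj S x + orth_proj S y"
  proof (rule orth_proj_eqI[OF assms])
    show "orth_proj S x + orth_proj S y \<in> S"
      by (simp add: assms orth_proj(1) subspace_add)
    fix s assume "s \<in> S"
    then show "orthogonal (x + y - (orth_proj S x + orth_proj S y)) s"
      using orth_proj(2)[OF assms, of s x] orth_proj(2)[OF assms, of s y]
      by (simp add: orthogonal_def algebra_simps)
  qed
next
  fix r x
  show "orth_proj S (r *\<^sub>R x) = r *\<^sub>R orth_proj S x"
  proof (rule orth_proj_eqI[OF assms])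
    show "r *\<^sub>R orth_proj S x \<in> S"
      by (simp add: assms orth_proj(1) subspace_scale)
    fix s assume "s \<in> S"
    then show "orthogonal (r *\<^sub>R x - r *\<^sub>R orth_proj S x) s"
      using orth_proj(2)[OF assms, of s x]
      by (simp add: orthogonal_def flip: scaleR_diff_right)
  qed
qed

lemma inner_orth_proj:
  assumes "subspace S" "s \<in> S"
  shows "x \<bullet> s = orth_proj S x \<bullet> s"
  using orth_proj(2)[OF assms, of x] by (simp add: orthogonal_def algebra_simps)

lemma norm_orth_proj_sq:
  assumes "subspace S"
  shows "(norm (orth_proj S x))\<^sup>2 = x \<bullet> orth_proj S x"
  using inner_orth_proj[OF assms orth_proj(1)[OF assms]] by (simp add: power2_norm_eq_inner)

lemma norm_diff_orth_proj_sq: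
  assumes "subspace S"
  shows "(norm (x - orth_proj S x))\<^sup>2 = (norm x)\<^sup>2 - (norm (orth_proj S x))\<^sup>2"
  using norm_orth_proj_sq[OF assms, of x] unfolding power2_norm_eq_inner
  by (simp add: algebra_simps inner_commute)

lemma measurable_orth_proj:
  assumes "subspace S"
  shows "orth_proj S \<in> borel_measurable borel"
  using linear_orth_proj[OF assms]
  by (intro borel_measurable_continuous_onI linear_continuous_on) (simp add: linear_linear)

section \<open>Control of the projection onto the span of all structures\<close>

text \<open>Expanding \<open>p\<close>, the projection of \<open>x\<close> onto the span, in a basis
  \<open>B\<close> taken from the union gives \<open>norm p ^ 2 = x \<bullet> p\<close> as a sum of
  coordinates of \<open>p\<close> times \<open>x \<bullet> b\<close>. Each \<open>b\<close> lies in
  some \<open>L (k b)\<close>, so \<open>x\<close> may be replaced there by its projection onto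
  \<open>L (k b)\<close>. The coordinates are at most a multiple of \<open>norm p\<close>, which
  then cancels.\<close>

lemma orth_proj_span_le:
  fixes L :: "'i \<Rightarrow> 'v::euclidean_space set"
  assumes sub: "\<And>i. i \<in> \<I> \<Longrightarrow> subspace (L i)"
  obtains F C where "finite F" "F \<subseteq> \<I>" "C \<ge> 0"
    "\<And>x. norm (orth_proj (span (\<Union>i\<in>\<I>. L i)) x) \<le> C * (\<Sum>i\<in>F. norm (orth_proj (L i) x))"
proof -
  let ?V = "span (\<Union>i\<in>\<I>. L i)"
  obtain B where B: "B \<subseteq> (\<Union>i\<in>\<I>. L i)" "independent B" "(\<Union>i\<in>\<I>. L i) \<subseteq> span B"
    using maximal_independent_subset[of "\<Union>i\<in>\<I>. L i"] by blast
  have fin: "finite B"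
    using B(2) by (rule independent_imp_finite)
  have VB: "?V = span B"
    using span_mono[OF B(1)] span_mono[OF B(3)] by (simp add: span_span)
  obtain k where k: "\<And>b. b \<in> B \<Longrightarrow> k b \<in> \<I> \<and> b \<in> L (k b)"
    using subsetD[OF B(1)] by (simp add: UN_iff Bex_def) metis
  \<comment> \<open>The coordinate functionals of the basis \<open>B\<close>, extended linearly to
    the whole space so that they have an operator norm.\<close>
  have "\<exists>g. linear g \<and> (\<forall>b'\<in>B. g b' = (if b' = b then 1 else 0 :: real))" for b
    using linear_independent_extend[OF B(2), of "\<lambda>b'. if b' = b then 1 else 0"] by simp
  then have "\<forall>b. \<exists>g. linear g \<and> (\<forall>b'\<in>B. g b' = (if b' = b then 1 else 0 :: real))"
    by (rule allI)
  from choice[OF this] obtain g where "\<forall>b. linear (g b) \<and> (\<forall>b'\<in>B. g b b' = (if b' = b then 1 else 0 :: real))"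
    by (rule exE)
  then have g: "\<And>b. linear (g b)" "\<And>b b'. b' \<in> B \<Longrightarrow> g b b' = (if b' = b then 1 else 0 :: real)"
    by simp_all
  have repr: "(\<Sum>b\<in>B. g b v *\<^sub>R b) = v" if "v \<in> span B" for v
  proof (rule linear_eq_on_span[of "\<lambda>v. \<Sum>b\<in>B. g b v *\<^sub>R b" "\<lambda>v. v" B, OF _ _ _ that])
    have "linear (\<lambda>v. g b v *\<^sub>R b)" for b
      by (rule linearI) (simp_all add: linear_add[OF g(1)] linear_cmul[OF g(1)] scaleR_add_left)
    then show "linear (\<lambda>v. \<Sum>b\<in>B. g b v *\<^sub>R b)"
      by (simp add: linear_compose_sum)
    show "linear (\<lambda>v::'v. v)" by (rule linear_ident)
  next
    fix b' assume "b' \<in> B"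
    then show "(\<Sum>b\<in>B. g b b' *\<^sub>R b) = b'"
      using fin by (simp add: g(2) if_distrib[of "\<lambda>c. c *\<^sub>R _"] cong: if_cong)
  qed
  define C where "C = (\<Sum>b\<in>B. onorm (g b) * norm b)"
  have bl: "bounded_linear (g b)" for b
    using g(1) by (simp add: linear_conv_bounded_linear)
  have C0: "C \<ge> 0"
    unfolding C_def by (intro sum_nonneg mult_nonneg_nonneg onorm_pos_le bl norm_ge_zero)
  have main: "norm (orth_proj ?V x) \<le> C * (\<Sum>i\<in>k ` B. norm (orth_proj (L i) x))" for x
  proof -
    let ?p = "orth_proj ?V x"
    define S where "S = (\<Sum>i\<in>k ` B. norm (orth_proj (L i) x))"
    have S0: "S \<ge> 0" by (simp add: S_def sum_nonneg)
    have p: "?p \<in> span B"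
      using orth_proj(1)[OF subspace_span] unfolding VB .
    have "(norm ?p)\<^sup>2 = x \<bullet> (\<Sum>b\<in>B. g b ?p *\<^sub>R b)"
      using norm_orth_proj_sq[OF subspace_span, of "\<Union>i\<in>\<I>. L i" x] by (simp only: repr[OF p])
    also have "\<dots> = (\<Sum>b\<in>B. g b ?p * (x \<bullet> b))"
      by (simp add: inner_sum_right)
    also have "\<dots> \<le> (\<Sum>b\<in>B. (onorm (g b) * norm ?p) * (S * norm b))"
    proof (rule sum_mono)
      fix b assume b: "b \<in> B"
      have "\<bar>x \<bullet> b\<bar> \<le> norm (orth_proj (L (k b)) x) * norm b"
        using inner_orth_proj[OF sub, of "k b" b x] k[OF b]
          Cauchy_Schwarz_ineq2[of "orth_proj (L (k b)) x" b] by simp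
      also have "\<dots> \<le> S * norm b"
        unfolding S_def using b fin by (intro mult_right_mono member_le_sum) auto
      finally have "\<bar>g b ?p\<bar> * \<bar>x \<bullet> b\<bar> \<le> (onorm (g b) * norm ?p) * (S * norm b)"
        using onorm[OF bl, of b ?p] onorm_pos_le[OF bl, of b]
        by (intro mult_mono) simp_all
      then show "g b ?p * (x \<bullet> b) \<le> (onorm (g b) * norm ?p) * (S * norm b)"
        using abs_ge_self[of "g b ?p * (x \<bullet> b)"] by (simp only: abs_mult)
    qed
    also have "\<dots> = norm ?p * (C * S)"
      unfolding C_def by (simp add: sum_distrib_left sum_distrib_right mult_ac)
    finally show ?thesis
      using C0 S0 unfolding S_def[symmetric] by (cases "norm ?p = 0") (simp_all add: power2_eq_square)
  qed
  show thesis
    by (rule that[of "k ` B" C]) (use fin k C0 main in auto)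
qed

text \<open>The sum over \<open>F\<close> is at most \<open>card F\<close> times its largest term,
  and the exponential belonging to that term is one of the summands on the right. The summand
  \<open>1\<close> covers empty \<open>F\<close>, where the projection onto the span
  vanishes.\<close>

lemma exp_orth_proj_span_le:
  fixes L :: "'i \<Rightarrow> 'v::euclidean_space set"
  assumes sub: "\<And>i. i \<in> \<I> \<Longrightarrow> subspace (L i)" and \<alpha>: "\<alpha> > 0"
  obtains F a where "finite F" "F \<subseteq> \<I>" "0 < a" "a \<le> 1"
    "\<And>x. exp (a * (norm (orth_proj (span (\<Union>i\<in>\<I>. L i)) x))\<^sup>2)
          \<le> 1 + (\<Sum>i\<in>F. exp (\<alpha> * (norm (orth_proj (L i) x))\<^sup>2))"
proof -
  obtain F C where F: "finite F" "F \<subseteq> \<I>" "C \<ge> 0"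
    and le: "\<And>x. norm (orth_proj (span (\<Union>i\<in>\<I>. L i)) x) \<le> C * (\<Sum>i\<in>F. norm (orth_proj (L i) x))"
    by (rule orth_proj_span_le[where \<I> = \<I> and L = L, OF sub]) (assumption | rule that)+
  define D where "D = C * card F"
  \<comment> \<open>Chosen to have \<open>a * D\<^sup>2 \<le> \<alpha>\<close>; the added
    \<open>1\<close> keeps the denominator positive when \<open>D = 0\<close>.\<close>
  define a where "a = min 1 (\<alpha> / (D\<^sup>2 + 1))"
  have D1: "D\<^sup>2 + 1 > 0" by (simp add: add_nonneg_pos)
  have a0: "0 < a" "a \<le> 1"
    unfolding a_def using \<alpha> D1 by auto
  have aD: "a * D\<^sup>2 \<le> \<alpha>"
  proof -
    have "a * D\<^sup>2 \<le> \<alpha> / (D\<^sup>2 + 1) * D\<^sup>2"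
      unfolding a_def by (intro mult_right_mono) auto
    also have "\<dots> \<le> \<alpha>"
      using \<alpha> D1 by (simp add: field_simps)
    finally show ?thesis .
  qed
  have "exp (a * (norm (orth_proj (span (\<Union>i\<in>\<I>. L i)) x))\<^sup>2)
          \<le> 1 + (\<Sum>i\<in>F. exp (\<alpha> * (norm (orth_proj (L i) x))\<^sup>2))" for x
  proof (cases "F = {}")
    case True
    then show ?thesis using le[of x] by simp
  next
    case False
    let ?n = "\<lambda>i. norm (orth_proj (L i) x)" and ?N = "norm (orth_proj (span (\<Union>i\<in>\<I>. L i)) x)"
    have "Max (?n ` F) \<in> ?n ` F"
      using F False by simp
    then obtain i where i: "i \<in> F" "Max (?n ` F) = ?n i"
      by auto
    then have "\<And>j. j \<in> F \<Longrightarrow> ?n j \<le> ?n i"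
      using F Max_ge[of "?n ` F"] by simp
    then have "(\<Sum>j\<in>F. ?n j) \<le> card F * ?n i"
      using sum_bounded_above[of F ?n "?n i"] by simp
    then have "?N \<le> D * ?n i"
      unfolding D_def using order_trans[OF le mult_left_mono[OF _ F(3)], of x "card F * ?n i"]
      by (simp only: mult.assoc)
    then have "?N\<^sup>2 \<le> D\<^sup>2 * (?n i)\<^sup>2"
      using power_mono[of ?N "D * ?n i" 2] by (simp add: power_mult_distrib)
    then have "a * ?N\<^sup>2 \<le> (a * D\<^sup>2) * (?n i)\<^sup>2"
      using a0 by (simp add: mult.assoc)
    also have "\<dots> \<le> \<alpha> * (?n i)\<^sup>2"
      using aD by (intro mult_right_mono) auto
    finally have "exp (a * ?N\<^sup>2) \<le> exp (\<alpha> * (?n i)\<^sup>2)" by simp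
    also have "\<dots> \<le> (\<Sum>i\<in>F. exp (\<alpha> * (?n i)\<^sup>2))"
      using F i by (intro member_le_sum) auto
    finally show ?thesis by simp
  qed
  then show thesis by (rule that[OF F(1,2) a0])
qed

text \<open>Stated for a general \<open>\<zeta>\<close> because it serves twice: for the noise
  \<open>\<xi>\<close> under \<open>P \<theta>\<close> and for the identity under
  \<open>PZ\<close>.\<close>

lemma nn_integral_exp_orth_proj_span_le:
  fixes L :: "'i \<Rightarrow> 'v::euclidean_space set"
  assumes "prob_space M" and meas: "\<zeta> \<in> borel_measurable M"
    and F: "finite F" "F \<subseteq> \<I>"
    and sub: "\<And>i. i \<in> \<I> \<Longrightarrow> subspace (L i)"
    and le: "\<And>x. exp (a * (norm (orth_proj (span (\<Union>i\<in>\<I>. L i)) x))\<^sup>2)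
          \<le> 1 + (\<Sum>i\<in>F. exp (\<alpha> * (norm (orth_proj (L i) x))\<^sup>2))"
    and mom: "\<And>i. i \<in> \<I> \<Longrightarrow> (\<integral>\<^sup>+\<omega>. ennreal (exp (\<alpha> * (norm (orth_proj (L i) (\<zeta> \<omega>)))\<^sup>2)) \<partial>M) \<le> ennreal (exp (d i))"
  shows "(\<integral>\<^sup>+\<omega>. ennreal (exp (a * (norm (orth_proj (span (\<Union>i\<in>\<I>. L i)) (\<zeta> \<omega>)))\<^sup>2)) \<partial>M)
          \<le> ennreal (1 + (\<Sum>i\<in>F. exp (d i)))"
proof -
  interpret prob_space M by fact
  have meas_i: "(\<lambda>\<omega>. ennreal (exp (\<alpha> * (norm (orth_proj (L i) (\<zeta> \<omega>)))\<^sup>2))) \<in> borel_measurable M"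
    if "i \<in> F" for i
  proof -
    have [measurable]: "(\<lambda>\<omega>. orth_proj (L i) (\<zeta> \<omega>)) \<in> borel_measurable M"
      using measurable_compose[OF meas measurable_orth_proj] sub F that by auto
    show ?thesis by measurable
  qed
  have "(\<integral>\<^sup>+\<omega>. ennreal (exp (a * (norm (orth_proj (span (\<Union>i\<in>\<I>. L i)) (\<zeta> \<omega>)))\<^sup>2)) \<partial>M)
      \<le> (\<integral>\<^sup>+\<omega>. 1 + (\<Sum>i\<in>F. ennreal (exp (\<alpha> * (norm (orth_proj (L i) (\<zeta> \<omega>)))\<^sup>2))) \<partial>M)"
  proof (rule nn_integral_mono)
    fix \<omega>
    have "ennreal (exp (a * (norm (orth_proj (span (\<Union>i\<in>\<I>. L i)) (\<zeta> \<omega>)))\<^sup>2))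
      \<le> ennreal (1 + (\<Sum>i\<in>F. exp (\<alpha> * (norm (orth_proj (L i) (\<zeta> \<omega>)))\<^sup>2)))"
      by (intro ennreal_leI le)
    then show "ennreal (exp (a * (norm (orth_proj (span (\<Union>i\<in>\<I>. L i)) (\<zeta> \<omega>)))\<^sup>2))
      \<le> 1 + (\<Sum>i\<in>F. ennreal (exp (\<alpha> * (norm (orth_proj (L i) (\<zeta> \<omega>)))\<^sup>2)))"
      by (simp add: sum_nonneg)
  qed
  also have "\<dots> = 1 + (\<Sum>i\<in>F. \<integral>\<^sup>+\<omega>. ennreal (exp (\<alpha> * (norm (orth_proj (L i) (\<zeta> \<omega>)))\<^sup>2)) \<partial>M)"
    using meas_i by (subst nn_integral_add) (auto simp: nn_integral_sum emeasure_space_1 simp flip: sum_ennreal)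
  also have "\<dots> \<le> 1 + (\<Sum>i\<in>F. ennreal (exp (d i)))"
    using F by (intro add_left_mono sum_mono mom) auto
  also have "\<dots> = ennreal (1 + (\<Sum>i\<in>F. exp (d i)))"
    by (simp add: sum_nonneg)
  finally show ?thesis .
qed

subsection \<open>Deterministic bounds for projection structures\<close>

text \<open>Chernoff's bound: the indicator of the larger event is at most
  \<open>exp (a * f \<omega> - c)\<close>. With \<open>A\<close> given only through an inclusion, a
  deviation event just has to be compared with a threshold for \<open>f\<close>.\<close>

lemma emeasure_le_exp_moment:
  assumes f[measurable]: "f \<in> borel_measurable M"
    and mom: "(\<integral>\<^sup>+\<omega>. ennreal (exp (a * f \<omega>)) \<partial>M) \<le> ennreal K"
    and A: "A \<subseteq> {\<omega> \<in> space M. c \<le> a * f \<omega>}"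
  shows "emeasure M A \<le> ennreal (K * exp (- c))"
proof -
  let ?B = "{\<omega> \<in> space M. c \<le> a * f \<omega>}"
  have B: "?B \<in> sets M" by measurable
  have "emeasure M A \<le> emeasure M ?B"
    using A B by (rule emeasure_mono)
  also have "\<dots> = (\<integral>\<^sup>+\<omega>. indicator ?B \<omega> \<partial>M)"
    using B by simp
  also have "\<dots> \<le> (\<integral>\<^sup>+\<omega>. ennreal (exp (- c)) * ennreal (exp (a * f \<omega>)) \<partial>M)"
    by (intro nn_integral_mono) (auto simp: indicator_def ennreal_mult[symmetric] exp_add[symmetric] simp flip: ennreal_1)
  also have "\<dots> = ennreal (exp (- c)) * (\<integral>\<^sup>+\<omega>. ennreal (exp (a * f \<omega>)) \<partial>M)"
    by (rule nn_integral_cmult) measurable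
  also have "\<dots> \<le> ennreal (exp (- c)) * ennreal K"
    using mom by (rule mult_left_mono) simp
  also have "\<dots> = ennreal (K * exp (- c))"
    by (metis ennreal_mult' exp_ge_zero mult.commute)
  finally show ?thesis .
qed

text \<open>The law of the noise is absent here: \<open>\<theta>\<close> and the noise value
  \<open>x\<close> are fixed vectors. Of the condition on the penalty constant only
  \<open>\<kappa> \<ge> 2\<close> and the bound on the sum of the penalties
  \<open>exp (- \<kappa> * \<rho> i)\<close> are retained.\<close>

locale projection_structures =
  fixes \<I> :: "'i set" and L :: "'i \<Rightarrow> 'v::euclidean_space set" and \<rho> :: "'i \<Rightarrow> real"
    and \<sigma> \<kappa> C :: real
  assumes sigma: "\<sigma> > 0"
    and kappa: "\<kappa> \<ge> 2"
    and nonempty: "\<I> \<noteq> {}"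
    and subspaces: "\<And>i. i \<in> \<I> \<Longrightarrow> subspace (L i)"
    and rho_nonneg: "\<And>i. i \<in> \<I> \<Longrightarrow> \<rho> i \<ge> 0"
    and C_pos: "C > 0"
    and summable_penalty: "(\<lambda>i. exp (- \<kappa> * \<rho> i)) summable_on \<I>"
    and infsum_penalty_le: "(\<Sum>\<^sub>\<infinity>i\<in>\<I>. exp (- \<kappa> * \<rho> i)) \<le> C"
begin

definition X :: "'v \<Rightarrow> real" where
  "X x = (norm (orth_proj (span (\<Union>i\<in>\<I>. L i)) x))\<^sup>2"

definition bias :: "'v \<Rightarrow> 'i \<Rightarrow> real" where
  "bias \<theta> i = (norm (\<theta> - orth_proj (L i) \<theta>))\<^sup>2"

text \<open>This is \<open>- 2 * \<sigma>\<^sup>2\<close> times the logarithm of the weight of the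
  structure, so the largest weight belongs to the smallest value.\<close>

definition crit :: "'v \<Rightarrow> 'i \<Rightarrow> real" where
  "crit y i = (norm (y - orth_proj (L i) y))\<^sup>2 + 2 * \<kappa> * \<sigma>\<^sup>2 * \<rho> i"

abbreviation rate :: "'v \<Rightarrow> real" where
  "rate \<theta> \<equiv> oracle_rate \<I> L \<rho> \<sigma> \<theta>"

definition minimiser :: "'v \<Rightarrow> 'i \<Rightarrow> bool" where
  "minimiser y h \<longleftrightarrow> h \<in> \<I> \<and> (\<forall>j\<in>\<I>. crit y h \<le> crit y j)"

lemma X_nonneg: "X x \<ge> 0"
  by (simp add: X_def)

lemma measurable_X [measurable]: "X \<in> borel_measurable borel"
proof -
  have [measurable]: "orth_proj (span (\<Union>i\<in>\<I>. L i)) \<in> borel_measurable borel"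
    by (rule measurable_orth_proj[OF subspace_span])
  show ?thesis unfolding X_def[abs_def] by measurable
qed

lemma L_subset_span: "i \<in> \<I> \<Longrightarrow> v \<in> L i \<Longrightarrow> v \<in> span (\<Union>i\<in>\<I>. L i)"
  by (blast intro: span_base)

lemma abs_inner_le_X:
  assumes "v \<in> span (\<Union>i\<in>\<I>. L i)"
  shows "\<bar>x \<bullet> v\<bar> \<le> sqrt (X x) * norm v"
  using inner_orth_proj[OF subspace_span assms, of x]
    Cauchy_Schwarz_ineq2[of "orth_proj (span (\<Union>i\<in>\<I>. L i)) x" v]
  by (simp add: X_def)

lemma norm_proj_le_X:
  assumes "i \<in> \<I>"
  shows "(norm (orth_proj (L i) x))\<^sup>2 \<le> X x"
proof -
  let ?p = "orth_proj (L i) x"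
  have "?p \<in> span (\<Union>i\<in>\<I>. L i)"
    using L_subset_span[OF assms] orth_proj(1) subspaces[OF assms] by blast
  from abs_inner_le_X[OF this, of x] have "(norm ?p)\<^sup>2 \<le> sqrt (X x) * norm ?p"
    using norm_orth_proj_sq[OF subspaces[OF assms], of x] by simp
  then have "norm ?p \<le> sqrt (X x)"
    using X_nonneg by (cases "norm ?p = 0") (simp_all add: power2_eq_square)
  then have "(norm ?p)\<^sup>2 \<le> (sqrt (X x))\<^sup>2"
    by (rule power_mono) simp
  then show ?thesis by (simp add: X_nonneg)
qed

text \<open>Needed for draws from the data dependent measure, where the noise \<open>x\<close> of
  the observation and the draw \<open>z\<close> from \<open>PZ\<close> add up.\<close>

lemma X_add_le: "X (x + z) \<le> 2 * X x + 2 * X z"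
proof -
  let ?P = "orth_proj (span (\<Union>i\<in>\<I>. L i))"
  have "?P (x + z) = ?P x + ?P z"
    by (rule linear_add[OF linear_orth_proj[OF subspace_span]])
  then have "X (x + z) \<le> (norm (?P x) + norm (?P z))\<^sup>2"
    unfolding X_def by (simp add: norm_triangle_ineq power_mono)
  also have "\<dots> \<le> 2 * (norm (?P x))\<^sup>2 + 2 * (norm (?P z))\<^sup>2"
    using sum_squares_bound[of "norm (?P x)" "norm (?P z)"] by (simp add: power2_sum)
  finally show ?thesis by (simp add: X_def)
qed

section \<open>Loss and residual of one structure, and comparison with the oracle\<close>

lemma proj_obs:
  assumes "i \<in> \<I>"
  shows "orth_proj (L i) (\<theta> + \<sigma> *\<^sub>R x) = orth_proj (L i) \<theta> + \<sigma> *\<^sub>R orth_proj (L i) x"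
  using linear_orth_proj[OF subspaces[OF assms]] by (simp add: linear_add linear_cmul)

lemma loss_eq:
  assumes "i \<in> \<I>"
  shows "(norm (orth_proj (L i) (\<theta> + \<sigma> *\<^sub>R x) - \<theta>))\<^sup>2 = bias \<theta> i + \<sigma>\<^sup>2 * (norm (orth_proj (L i) x))\<^sup>2"
proof -
  have "orthogonal (\<theta> - orth_proj (L i) \<theta>) (orth_proj (L i) x)"
    using orth_proj subspaces[OF assms] by blast
  then show ?thesis
    unfolding proj_obs[OF assms] bias_def power2_norm_eq_inner orthogonal_def
    by (simp add: algebra_simps power2_eq_square inner_commute)
qed

text \<open>The bias vector is orthogonal to \<open>L i\<close>, so its product with the projected
  noise drops out. The term with \<open>norm x\<close> is the same for all structures and cancels
  when two residuals are compared.\<close>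

lemma residual_eq:
  assumes "i \<in> \<I>"
  shows "(norm (\<theta> + \<sigma> *\<^sub>R x - orth_proj (L i) (\<theta> + \<sigma> *\<^sub>R x)))\<^sup>2
    = bias \<theta> i + 2 * \<sigma> * (x \<bullet> (\<theta> - orth_proj (L i) \<theta>)) + \<sigma>\<^sup>2 * ((norm x)\<^sup>2 - (norm (orth_proj (L i) x))\<^sup>2)"
proof -
  let ?u = "\<theta> - orth_proj (L i) \<theta>" and ?w = "x - orth_proj (L i) x"
  have "orthogonal ?u (orth_proj (L i) x)"
    using orth_proj subspaces[OF assms] by blast
  then have cross: "?u \<bullet> ?w = x \<bullet> ?u"
    unfolding orthogonal_def inner_diff_right[of ?u] by (simp add: inner_commute)
  have split: "\<theta> + \<sigma> *\<^sub>R x - orth_proj (L i) (\<theta> + \<sigma> *\<^sub>R x) = ?u + \<sigma> *\<^sub>R ?w"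
    unfolding proj_obs[OF assms] by (simp add: algebra_simps)
  have "(norm (u + \<sigma> *\<^sub>R w))\<^sup>2 = (norm u)\<^sup>2 + 2 * \<sigma> * (u \<bullet> w) + \<sigma>\<^sup>2 * (norm w)\<^sup>2" for u w :: 'v
    unfolding power2_norm_eq_inner by (simp add: algebra_simps power2_eq_square inner_commute)
  then show ?thesis
    unfolding split bias_def norm_diff_orth_proj_sq[OF subspaces[OF assms], of x, symmetric] cross[symmetric] .
qed

text \<open>In the difference of the two residuals the cross terms combine to the product of
  \<open>x\<close> with \<open>?e\<close>. This vector lies in the span, so
  \<open>sqrt (X x)\<close> bounds the product even when \<open>L i\<close> and \<open>L j\<close>
  enclose a small angle, and \<open>norm ?e\<close> is at most the sum of the two bias
  norms.\<close>

lemma residual_diff: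
  fixes \<theta> x :: 'v
  assumes i: "i \<in> \<I>" and j: "j \<in> \<I>"
  defines "y \<equiv> \<theta> + \<sigma> *\<^sub>R x"
  shows "(norm (y - orth_proj (L j) y))\<^sup>2 + bias \<theta> i / 2
    \<le> (norm (y - orth_proj (L i) y))\<^sup>2 + 2 * bias \<theta> j + 4 * \<sigma>\<^sup>2 * X x"
proof -
  define u v n where "u = norm (\<theta> - orth_proj (L i) \<theta>)" "v = norm (\<theta> - orth_proj (L j) \<theta>)"
    "n = sqrt (X x)"
  let ?e = "orth_proj (L i) \<theta> - orth_proj (L j) \<theta>"
  have "?e \<in> span (\<Union>i\<in>\<I>. L i)"
    using i j by (intro span_diff L_subset_span[OF i] L_subset_span[OF j] orth_proj(1) subspaces)
  then have "\<bar>x \<bullet> ?e\<bar> \<le> n * norm ?e"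
    unfolding u_v_n_def by (rule abs_inner_le_X)
  also have "\<dots> \<le> n * (u + v)"
  proof -
    have "norm ?e \<le> u + v"
      using norm_triangle_ineq4[of "\<theta> - orth_proj (L j) \<theta>" "\<theta> - orth_proj (L i) \<theta>"]
      by (simp add: u_v_n_def)
    then show ?thesis by (simp add: mult_left_mono u_v_n_def X_nonneg)
  qed
  finally have "2 * \<sigma> * (x \<bullet> ?e) \<le> 2 * \<sigma> * (n * (u + v))"
    using sigma by simp
  \<comment> \<open>The weights are unequal: only half of \<open>bias \<theta> i\<close> may be
    spent, as the other half must survive, whereas \<open>bias \<theta> j\<close> may be doubled.
    The noise costs \<open>2 + 1\<close> here and \<open>1\<close> more for the projection of
    \<open>x\<close> onto \<open>L i\<close>, in all
    \<open>4 * \<sigma>\<^sup>2 * X x\<close>.\<close>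
  moreover have "(\<sigma> * n) * u * 2 \<le> u\<^sup>2 / 2 + 2 * (\<sigma> * n)\<^sup>2"
    using zero_le_power2[of "u / 2 - \<sigma> * n"] by (simp add: power2_eq_square field_simps)
  moreover have "(\<sigma> * n) * v * 2 \<le> v\<^sup>2 + (\<sigma> * n)\<^sup>2"
    using zero_le_power2[of "v - \<sigma> * n"] by (simp add: power2_eq_square field_simps)
  moreover have "2 * \<sigma> * (n * (u + v)) = (\<sigma> * n) * u * 2 + (\<sigma> * n) * v * 2"
    by (simp add: algebra_simps)
  moreover have "(\<sigma> * n)\<^sup>2 = \<sigma>\<^sup>2 * X x"
    by (simp add: u_v_n_def X_nonneg power_mult_distrib)
  moreover have "\<sigma>\<^sup>2 * (norm (orth_proj (L i) x))\<^sup>2 \<le> \<sigma>\<^sup>2 * X x" "0 \<le> \<sigma>\<^sup>2 * (norm (orth_proj (L j) x))\<^sup>2"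
    by (simp_all add: mult_left_mono norm_proj_le_X i)
  moreover have "bias \<theta> i = u\<^sup>2" "bias \<theta> j = v\<^sup>2"
    by (simp_all add: bias_def u_v_n_def)
  moreover have "2 * \<sigma> * (x \<bullet> ?e) = 2 * \<sigma> * (x \<bullet> (\<theta> - orth_proj (L j) \<theta>)) - 2 * \<sigma> * (x \<bullet> (\<theta> - orth_proj (L i) \<theta>))"
    by (simp add: inner_diff_right algebra_simps)
  ultimately show ?thesis
    unfolding y_def residual_eq[OF i] residual_eq[OF j] right_diff_distrib[of "\<sigma>\<^sup>2"]
    by linarith
qed

text \<open>Bounds are proved against every competitor \<open>j\<close> and then passed to the
  infimum, so no structure attaining the oracle rate has to be exhibited.\<close>

lemma le_oracle_rate:
  assumes "\<And>j. j \<in> \<I> \<Longrightarrow> u \<le> w + \<kappa>' * struct_rate L \<rho> \<sigma> j \<theta>" and "\<kappa>' > 0"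
  shows "u \<le> w + \<kappa>' * rate \<theta>"
proof -
  have "(u - w) / \<kappa>' \<le> rate \<theta>"
    unfolding oracle_rate_def using nonempty assms
    by (intro cINF_greatest) (simp_all add: field_simps)
  then show ?thesis using assms(2) by (simp add: field_simps)
qed

lemma rate_nonneg: "rate \<theta> \<ge> 0"
  unfolding oracle_rate_def using nonempty
  by (intro cINF_greatest) (simp_all add: struct_rate_def rho_nonneg)

text \<open>The basic inequality: \<open>h\<close> beats every \<open>j\<close>, \<open>j\<close> is
  compared with \<open>i\<close> by \<open>residual_diff\<close>, and
  \<open>2 * bias \<theta> j\<close> together with the penalty of \<open>j\<close> is at most
  \<open>2 * \<kappa>\<close> times the rate of \<open>j\<close>. For \<open>i = h\<close> it bounds
  the bias and complexity of the selected structure; for other \<open>i\<close> it makes the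
  posterior weight decay.\<close>

lemma minimiser_gap:
  assumes h: "minimiser (\<theta> + \<sigma> *\<^sub>R x) h" and i: "i \<in> \<I>"
  shows "crit (\<theta> + \<sigma> *\<^sub>R x) h + bias \<theta> i / 2 + 2 * \<kappa> * \<sigma>\<^sup>2 * \<rho> i
    \<le> crit (\<theta> + \<sigma> *\<^sub>R x) i + 4 * \<sigma>\<^sup>2 * X x + 2 * \<kappa> * rate \<theta>"
proof (rule le_oracle_rate)
  fix j assume j: "j \<in> \<I>"
  have "2 * bias \<theta> j \<le> 2 * \<kappa> * bias \<theta> j"
    using kappa by (intro mult_right_mono) (simp_all add: bias_def)
  moreover have "crit (\<theta> + \<sigma> *\<^sub>R x) h \<le> crit (\<theta> + \<sigma> *\<^sub>R x) j"
    using h j by (simp add: minimiser_def)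
  ultimately show "crit (\<theta> + \<sigma> *\<^sub>R x) h + bias \<theta> i / 2 + 2 * \<kappa> * \<sigma>\<^sup>2 * \<rho> i
    \<le> crit (\<theta> + \<sigma> *\<^sub>R x) i + 4 * \<sigma>\<^sup>2 * X x + 2 * \<kappa> * struct_rate L \<rho> \<sigma> j \<theta>"
    using residual_diff[OF i j, of \<theta> x]
    unfolding crit_def struct_rate_def bias_def[symmetric] by (simp add: algebra_simps)
qed (use kappa in simp)

text \<open>The quantity called \<open>B\<close> in the overview; below, \<open>B\<close> denotes a
  set. It is twice the slack in \<open>minimiser_gap\<close>, where the bias carries the factor one
  half.\<close>

definition level :: "'v \<Rightarrow> 'v \<Rightarrow> real" where
  "level \<theta> x = 4 * \<kappa> * rate \<theta> + 8 * \<sigma>\<^sup>2 * X x"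

lemma level_nonneg: "level \<theta> x \<ge> 0"
  using kappa by (simp add: level_def rate_nonneg X_nonneg)

lemma minimiser_bias_le:
  assumes "minimiser (\<theta> + \<sigma> *\<^sub>R x) h"
  shows "bias \<theta> h \<le> level \<theta> x"
proof -
  have h: "h \<in> \<I>" using assms by (simp add: minimiser_def)
  have "0 \<le> 2 * \<kappa> * \<sigma>\<^sup>2 * \<rho> h"
    using kappa rho_nonneg[OF h] by simp
  then show ?thesis
    using minimiser_gap[OF assms h] unfolding level_def by linarith
qed

lemma minimiser_rho_le:
  assumes "minimiser (\<theta> + \<sigma> *\<^sub>R x) h"
  shows "\<sigma>\<^sup>2 * \<rho> h \<le> rate \<theta> + \<sigma>\<^sup>2 * X x"
proof -
  have h: "h \<in> \<I>" using assms by (simp add: minimiser_def)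
  have "0 \<le> bias \<theta> h" by (simp add: bias_def)
  \<comment> \<open>Here \<open>\<kappa> \<ge> 2\<close> absorbs the noise coefficient, so that
    dividing by \<open>\<kappa>\<close> leaves constants equal to one.\<close>
  moreover have "2 * (\<sigma>\<^sup>2 * X x) \<le> \<kappa> * (\<sigma>\<^sup>2 * X x)"
    using kappa by (intro mult_right_mono) (simp_all add: X_nonneg)
  ultimately have "\<kappa> * (\<sigma>\<^sup>2 * \<rho> h) \<le> \<kappa> * (rate \<theta> + \<sigma>\<^sup>2 * X x)"
    using minimiser_gap[OF assms h] by (simp add: algebra_simps)
  then show ?thesis using kappa by simp
qed

section \<open>Posterior weights of the structures and losses of the estimators\<close>

abbreviation weight :: "'v \<Rightarrow> 'i \<Rightarrow> real" where
  "weight \<equiv> struct_weight L \<rho> \<kappa> \<sigma>"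

abbreviation post :: "'v \<Rightarrow> 'i \<Rightarrow> real" where
  "post \<equiv> struct_post \<I> L \<rho> \<kappa> \<sigma>"

lemma weight_eq: "weight y i = exp (- crit y i / (2 * \<sigma>\<^sup>2))"
  using sigma by (simp add: struct_weight_def crit_def exp_add[symmetric] field_simps)

lemma weight_pos: "weight y i > 0"
  by (simp add: weight_eq)

lemma summable_weight: "weight y summable_on \<I>"
proof (rule summable_on_comparison_test[OF summable_penalty])
  show "weight y i \<le> exp (- \<kappa> * \<rho> i)" for i
    unfolding struct_weight_def by (simp add: mult_left_le)
qed (simp add: less_imp_le weight_pos)

lemma weight_le_infsum:
  assumes "i \<in> \<I>"
  shows "weight y i \<le> infsum (weight y) \<I>"
  using finite_sum_le_infsum[OF summable_weight, of "{i}" y] assms by (simp add: less_imp_le weight_pos)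

lemma infsum_weight_pos: "infsum (weight y) \<I> > 0"
  using nonempty weight_le_infsum weight_pos by (metis ex_in_conv order_less_le_trans)

lemma post_nonneg: "post y i \<ge> 0"
  unfolding struct_post_def using infsum_weight_pos[of y] weight_pos[of y i] by simp

lemma post_has_sum: "(post y has_sum 1) \<I>"
  using has_sum_cmult_right[OF has_sum_infsum[OF summable_weight[of y]], of "inverse (infsum (weight y) \<I>)"]
    infsum_weight_pos[of y]
  by (simp add: struct_post_def[abs_def] field_simps)

lemma is_arg_max_minimiser:
  assumes "is_arg_max (post y) (\<lambda>i. i \<in> \<I>) h"
  shows "minimiser y h"
proof -
  have h: "h \<in> \<I>" "\<And>j. j \<in> \<I> \<Longrightarrow> post y j \<le> post y h"
    using assms by (auto simp: is_arg_max_linorder)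
  have "crit y h \<le> crit y j" if "j \<in> \<I>" for j
  proof -
    have "weight y j \<le> weight y h"
      using h(2)[OF that] infsum_weight_pos[of y] by (simp add: struct_post_def divide_le_cancel)
    then show ?thesis
      using sigma by (simp add: weight_eq divide_le_cancel)
  qed
  then show ?thesis using h by (simp add: minimiser_def)
qed

text \<open>The normalising sum is bounded below by its single term at \<open>h\<close>, and
  \<open>minimiser_gap\<close> bounds the remaining ratio. The full penalty factor survives, which
  keeps the later sums over \<open>i\<close> finite.\<close>

lemma post_le:
  assumes h: "minimiser (\<theta> + \<sigma> *\<^sub>R x) h" and i: "i \<in> \<I>"
  shows "post (\<theta> + \<sigma> *\<^sub>R x) i \<le> exp (- \<kappa> * \<rho> i) * exp (- ((bias \<theta> i - level \<theta> x) / (4 * \<sigma>\<^sup>2)))"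
proof -
  let ?y = "\<theta> + \<sigma> *\<^sub>R x"
  have "post ?y i \<le> weight ?y i / weight ?y h"
    unfolding struct_post_def using h
    by (intro divide_left_mono weight_le_infsum mult_pos_pos weight_pos infsum_weight_pos)
      (simp_all add: minimiser_def less_imp_le weight_pos)
  also have "\<dots> = exp ((crit ?y h - crit ?y i) / (2 * \<sigma>\<^sup>2))"
    unfolding weight_eq exp_diff[symmetric] by (simp add: diff_divide_distrib)
  also have "\<dots> \<le> exp ((4 * \<sigma>\<^sup>2 * X x + 2 * \<kappa> * rate \<theta> - bias \<theta> i / 2 - 2 * \<kappa> * \<sigma>\<^sup>2 * \<rho> i) / (2 * \<sigma>\<^sup>2))"
    using minimiser_gap[OF h i] by (simp add: divide_right_mono)
  also have "\<dots> = exp (- \<kappa> * \<rho> i) * exp (- ((bias \<theta> i - level \<theta> x) / (4 * \<sigma>\<^sup>2)))"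
    unfolding exp_add[symmetric] level_def using sigma by (simp add: field_simps)
  finally show ?thesis .
qed

text \<open>A positive excess of the bias over the level is beaten by the exponential decay in
  \<open>post_le\<close>, because \<open>z * exp (- z) \<le> 1\<close>; summing over
  \<open>i\<close> then costs only \<open>4 * \<sigma>\<^sup>2 * C\<close>.\<close>

lemma post_excess_le:
  assumes h: "minimiser (\<theta> + \<sigma> *\<^sub>R x) h" and i: "i \<in> \<I>"
  shows "post (\<theta> + \<sigma> *\<^sub>R x) i * (bias \<theta> i - level \<theta> x) \<le> 4 * \<sigma>\<^sup>2 * exp (- \<kappa> * \<rho> i)"
proof (cases "bias \<theta> i \<le> level \<theta> x")
  case True
  then have "post (\<theta> + \<sigma> *\<^sub>R x) i * (bias \<theta> i - level \<theta> x) \<le> 0"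
    by (simp add: mult_nonneg_nonpos post_nonneg)
  also have "\<dots> \<le> 4 * \<sigma>\<^sup>2 * exp (- \<kappa> * \<rho> i)" by simp
  finally show ?thesis .
next
  case False
  define z where "z = (bias \<theta> i - level \<theta> x) / (4 * \<sigma>\<^sup>2)"
  have z: "bias \<theta> i - level \<theta> x = 4 * \<sigma>\<^sup>2 * z" "z > 0"
    using sigma False by (simp_all add: z_def)
  have "exp (- z) * z \<le> 1"
    using order_trans[OF _ exp_ge_add_one_self, of z z] by (simp add: exp_minus field_simps)
  have "post (\<theta> + \<sigma> *\<^sub>R x) i * (4 * \<sigma>\<^sup>2 * z) \<le> (exp (- \<kappa> * \<rho> i) * exp (- z)) * (4 * \<sigma>\<^sup>2 * z)"
    using post_le[OF h i, folded z_def] z(2) by (intro mult_right_mono) simp_all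
  also have "\<dots> = 4 * \<sigma>\<^sup>2 * exp (- \<kappa> * \<rho> i) * (exp (- z) * z)"
    by simp
  also have "\<dots> \<le> 4 * \<sigma>\<^sup>2 * exp (- \<kappa> * \<rho> i)"
    using \<open>exp (- z) * z \<le> 1\<close> by (intro mult_left_le) simp_all
  finally show ?thesis unfolding z(1) .
qed

text \<open>In place of Jensen's inequality, \<open>2 * w * sqrt Q \<le> Q + w\<^sup>2\<close> turns
  the norm \<open>w\<close> of each error into its square, whose posterior average is controlled by
  \<open>post_excess_le\<close>.\<close>

lemma est_mix_loss_le:
  assumes h: "minimiser (\<theta> + \<sigma> *\<^sub>R x) h"
  shows "(norm (est_mix \<I> L \<rho> \<kappa> \<sigma> (\<theta> + \<sigma> *\<^sub>R x) - \<theta>))\<^sup>2 \<le> 4 * \<kappa> * rate \<theta> + 9 * \<sigma>\<^sup>2 * X x + 4 * \<sigma>\<^sup>2 * C"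
proof -
  let ?y = "\<theta> + \<sigma> *\<^sub>R x" and ?E = "infsum (\<lambda>i. exp (- \<kappa> * \<rho> i)) \<I>"
  define D where "D = level \<theta> x + \<sigma>\<^sup>2 * X x"
  \<comment> \<open>\<open>Q\<close> is both the bound aimed at and the balancing parameter; the
    part with \<open>C\<close> makes it positive, so division by \<open>sqrt Q\<close> is
    safe.\<close>
  define Q where "Q = D + 4 * \<sigma>\<^sup>2 * C"
  have D0: "D \<ge> 0"
    by (simp add: D_def level_nonneg X_nonneg)
  have Q0: "Q > 0"
    using D0 sigma C_pos by (simp add: Q_def add_nonneg_pos)
  have post_sum: "(\<lambda>i. post ?y i) summable_on \<I>"
    using post_has_sum by (rule has_sum_imp_summable)
  \<comment> \<open>Ensures that \<open>est_mix\<close> is the value of a convergent series and not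
    the default value zero.\<close>
  have summable: "(\<lambda>i. post ?y i *\<^sub>R orth_proj (L i) ?y) summable_on \<I>"
  proof (rule abs_summable_summable, rule summable_on_comparison_test)
    show "(\<lambda>i. norm ?y * post ?y i) summable_on \<I>"
      using post_sum by (rule summable_on_cmult_right)
    fix i assume i: "i \<in> \<I>"
    have "(norm (orth_proj (L i) ?y))\<^sup>2 \<le> (norm ?y)\<^sup>2"
      using norm_diff_orth_proj_sq[OF subspaces[OF i], of ?y]
        zero_le_power2[of "norm (?y - orth_proj (L i) ?y)"] by linarith
    then have "norm (orth_proj (L i) ?y) \<le> norm ?y"
      by (rule power2_le_imp_le) simp
    then show "norm (post ?y i *\<^sub>R orth_proj (L i) ?y) \<le> norm ?y * post ?y i"
      using mult_left_mono[OF _ post_nonneg] by (simp add: post_nonneg mult.commute)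
  qed simp
  \<comment> \<open>Since the posterior weights sum to one, \<open>\<theta>\<close> can be
    subtracted inside the series.\<close>
  have "((\<lambda>i. post ?y i *\<^sub>R orth_proj (L i) ?y + post ?y i *\<^sub>R (- \<theta>)) has_sum (est_mix \<I> L \<rho> \<kappa> \<sigma> ?y + 1 *\<^sub>R (- \<theta>))) \<I>"
    unfolding est_mix_def
    by (intro has_sum_add has_sum_infsum[OF summable]
        has_sum_bounded_linear[OF bounded_linear_scaleR_left post_has_sum])
  then have diff: "((\<lambda>i. post ?y i *\<^sub>R (orth_proj (L i) ?y - \<theta>)) has_sum (est_mix \<I> L \<rho> \<kappa> \<sigma> ?y - \<theta>)) \<I>"
    by (simp add: scaleR_diff_right)
  have dom: "((\<lambda>i. ((Q + D) * post ?y i + 4 * \<sigma>\<^sup>2 * exp (- \<kappa> * \<rho> i)) * inverse (2 * sqrt Q))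
      has_sum (((Q + D) * 1 + 4 * \<sigma>\<^sup>2 * ?E) * inverse (2 * sqrt Q))) \<I>"
    by (intro has_sum_cmult_left has_sum_add has_sum_cmult_right post_has_sum has_sum_infsum summable_penalty)
  have "norm (est_mix \<I> L \<rho> \<kappa> \<sigma> ?y - \<theta>) \<le> ((Q + D) * 1 + 4 * \<sigma>\<^sup>2 * ?E) * inverse (2 * sqrt Q)"
  proof (rule norm_infsum_le[OF diff dom])
    fix i assume i: "i \<in> \<I>"
    define w where "w = norm (orth_proj (L i) ?y - \<theta>)"
    have "w * (2 * sqrt Q) \<le> Q + w\<^sup>2"
      using sum_squares_bound[of "sqrt Q" w] Q0 by (simp add: mult_ac)
    then have "post ?y i * (w * (2 * sqrt Q)) \<le> post ?y i * (Q + w\<^sup>2)"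
      by (rule mult_left_mono) (rule post_nonneg)
    also have "\<dots> \<le> post ?y i * (Q + D + (bias \<theta> i - level \<theta> x))"
    proof (rule mult_left_mono[OF _ post_nonneg])
      have "\<sigma>\<^sup>2 * (norm (orth_proj (L i) x))\<^sup>2 \<le> \<sigma>\<^sup>2 * X x"
        by (simp add: mult_left_mono norm_proj_le_X i)
      then show "Q + w\<^sup>2 \<le> Q + D + (bias \<theta> i - level \<theta> x)"
        unfolding w_def loss_eq[OF i] D_def by simp
    qed
    also have "\<dots> \<le> (Q + D) * post ?y i + 4 * \<sigma>\<^sup>2 * exp (- \<kappa> * \<rho> i)"
      using post_excess_le[OF h i] by (simp add: algebra_simps)
    finally show "norm (post ?y i *\<^sub>R (orth_proj (L i) ?y - \<theta>))
        \<le> ((Q + D) * post ?y i + 4 * \<sigma>\<^sup>2 * exp (- \<kappa> * \<rho> i)) * inverse (2 * sqrt Q)"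
      unfolding norm_scaleR w_def[symmetric] using Q0 post_nonneg[of ?y i]
      by (simp add: field_simps)
  qed
  also have "\<dots> \<le> (2 * Q) * inverse (2 * sqrt Q)"
  proof (rule mult_right_mono)
    have "4 * \<sigma>\<^sup>2 * ?E \<le> 4 * \<sigma>\<^sup>2 * C"
      using infsum_penalty_le by (intro mult_left_mono) simp_all
    then show "(Q + D) * 1 + 4 * \<sigma>\<^sup>2 * ?E \<le> 2 * Q"
      by (simp add: Q_def algebra_simps)
  qed (use Q0 in simp)
  also have "\<dots> = sqrt Q"
    using Q0 real_sqrt_mult_self[of Q] by (simp add: field_simps)
  finally have "(norm (est_mix \<I> L \<rho> \<kappa> \<sigma> ?y - \<theta>))\<^sup>2 \<le> (sqrt Q)\<^sup>2"
    by (rule power_mono) simp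
  also have "\<dots> = Q" using Q0 by simp
  finally show ?thesis
    by (simp add: Q_def D_def level_def mult_ac)
qed

text \<open>The bound is deliberately that of \<open>est_mix\<close>, so that both estimators can be
  treated at once.\<close>

lemma est_sel_loss_le:
  assumes "minimiser (\<theta> + \<sigma> *\<^sub>R x) (Ihat (\<theta> + \<sigma> *\<^sub>R x))"
  shows "(norm (est_sel L Ihat (\<theta> + \<sigma> *\<^sub>R x) - \<theta>))\<^sup>2 \<le> 4 * \<kappa> * rate \<theta> + 9 * \<sigma>\<^sup>2 * X x + 4 * \<sigma>\<^sup>2 * C"
proof -
  let ?h = "Ihat (\<theta> + \<sigma> *\<^sub>R x)"
  have h: "?h \<in> \<I>" using assms by (simp add: minimiser_def)
  have "\<sigma>\<^sup>2 * (norm (orth_proj (L ?h) x))\<^sup>2 \<le> \<sigma>\<^sup>2 * X x" "0 \<le> 4 * \<sigma>\<^sup>2 * C"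
    using C_pos by (simp_all add: mult_left_mono norm_proj_le_X h)
  then show ?thesis
    using minimiser_bias_le[OF assms] unfolding est_sel_def loss_eq[OF h] level_def by linarith
qed

section \<open>Mass that the data dependent measures put far from \<open>\<theta>\<close>\<close>

context
  fixes PZ :: "'v measure" and b K M :: real and B :: "'v set" and \<theta> :: 'v
  assumes sets_PZ: "sets PZ = sets borel"
    and b: "0 < b" "b \<le> 1 / 4" and K: "K \<ge> 0"
    and mom: "(\<integral>\<^sup>+z. ennreal (exp (2 * b * X z)) \<partial>PZ) \<le> ennreal K"
    and B: "B \<subseteq> {v. 4 * \<kappa> * rate \<theta> + M * \<sigma>\<^sup>2 \<le> (norm (v - \<theta>))\<^sup>2}"
begin

text \<open>A draw from the component \<open>i\<close> is the projection of
  \<open>\<theta> + \<sigma> *\<^sub>R (x + z)\<close>, so \<open>loss_eq\<close> applies with noise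
  \<open>x + z\<close> and Chernoff's bound is taken in \<open>z\<close>. Of the coefficient
  \<open>10\<close>, a part \<open>8\<close> comes from \<open>level\<close> and \<open>2\<close>
  from \<open>X_add_le\<close>, which also explains the factor \<open>2\<close> in the moment
  assumption.\<close>

lemma ddm_struct_le:
  assumes i: "i \<in> \<I>"
  shows "ddm_struct L \<sigma> PZ i (\<theta> + \<sigma> *\<^sub>R x) B
    \<le> exp (b * ((bias \<theta> i - level \<theta> x) / \<sigma>\<^sup>2)) * (K * exp (b * (10 * X x - M)))"
proof -
  let ?c = "b * (M - 10 * X x - (bias \<theta> i - level \<theta> x) / \<sigma>\<^sup>2)"
  have "?c \<le> 2 * b * X z" if z: "orth_proj (L i) (\<theta> + \<sigma> *\<^sub>R x) + \<sigma> *\<^sub>R orth_proj (L i) z \<in> B" for z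
  proof -
    have "orth_proj (L i) (\<theta> + \<sigma> *\<^sub>R x) + \<sigma> *\<^sub>R orth_proj (L i) z = orth_proj (L i) (\<theta> + \<sigma> *\<^sub>R (x + z))"
      unfolding scaleR_add_right add.assoc[symmetric] proj_obs[OF i, symmetric] ..
    then have "4 * \<kappa> * rate \<theta> + M * \<sigma>\<^sup>2 \<le> bias \<theta> i + \<sigma>\<^sup>2 * (norm (orth_proj (L i) (x + z)))\<^sup>2"
      using z B loss_eq[OF i] by auto
    also have "\<dots> \<le> bias \<theta> i + \<sigma>\<^sup>2 * (2 * X x + 2 * X z)"
      using order_trans[OF norm_proj_le_X[OF i] X_add_le] by (intro add_left_mono mult_left_mono) simp_all
    finally have "M - 10 * X x - (bias \<theta> i - level \<theta> x) / \<sigma>\<^sup>2 \<le> 2 * X z"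
      using sigma by (simp add: level_def field_simps)
    from mult_left_mono[OF this, of b] show ?thesis
      using b by (simp add: mult_ac)
  qed
  then have "emeasure PZ {z \<in> space PZ. orth_proj (L i) (\<theta> + \<sigma> *\<^sub>R x) + \<sigma> *\<^sub>R orth_proj (L i) z \<in> B}
      \<le> ennreal (K * exp (- ?c))"
    using sets_PZ by (intro emeasure_le_exp_moment[OF _ mom]) (auto cong: measurable_cong_sets)
  then have "ddm_struct L \<sigma> PZ i (\<theta> + \<sigma> *\<^sub>R x) B \<le> K * exp (- ?c)"
    unfolding ddm_struct_def measure_def using K by (intro enn2real_leI) simp_all
  also have "\<dots> = exp (b * ((bias \<theta> i - level \<theta> x) / \<sigma>\<^sup>2)) * (K * exp (b * (10 * X x - M)))"
    by (simp add: exp_add[symmetric] algebra_simps)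
  finally show ?thesis .
qed

lemma ddm_sel_le:
  assumes "minimiser (\<theta> + \<sigma> *\<^sub>R x) (Ihat (\<theta> + \<sigma> *\<^sub>R x))"
  shows "ddm_sel L \<sigma> PZ Ihat (\<theta> + \<sigma> *\<^sub>R x) B \<le> (1 + C) * (K * exp (b * (10 * X x - M)))"
proof -
  let ?h = "Ihat (\<theta> + \<sigma> *\<^sub>R x)"
  have h: "?h \<in> \<I>" using assms by (simp add: minimiser_def)
  have "b * ((bias \<theta> ?h - level \<theta> x) / \<sigma>\<^sup>2) \<le> 0"
    using minimiser_bias_le[OF assms] b sigma by (simp add: mult_nonneg_nonpos divide_nonpos_pos)
  then have "exp (b * ((bias \<theta> ?h - level \<theta> x) / \<sigma>\<^sup>2)) \<le> 1 + C"
    using C_pos by (smt (verit) exp_le_one_iff)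
  then show ?thesis
    unfolding ddm_sel_def using K by (intro order_trans[OF ddm_struct_le[OF h]] mult_right_mono) simp_all
qed

text \<open>Below the level the exponential is at most one, which gives the first summand. Above it,
  \<open>b \<le> 1 / 4\<close> lets the decay in \<open>post_le\<close> absorb the exponential,
  which gives the second. Both summands are summable, with total at most
  \<open>1 + C\<close>.\<close>

lemma post_exp_le:
  assumes h: "minimiser (\<theta> + \<sigma> *\<^sub>R x) h" and i: "i \<in> \<I>"
  shows "post (\<theta> + \<sigma> *\<^sub>R x) i * exp (b * ((bias \<theta> i - level \<theta> x) / \<sigma>\<^sup>2))
    \<le> post (\<theta> + \<sigma> *\<^sub>R x) i + exp (- \<kappa> * \<rho> i)"
proof (cases "bias \<theta> i \<le> level \<theta> x")
  case True
  then have "b * ((bias \<theta> i - level \<theta> x) / \<sigma>\<^sup>2) \<le> 0"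
    using b sigma by (simp add: mult_nonneg_nonpos divide_nonpos_pos)
  then have "post (\<theta> + \<sigma> *\<^sub>R x) i * exp (b * ((bias \<theta> i - level \<theta> x) / \<sigma>\<^sup>2)) \<le> post (\<theta> + \<sigma> *\<^sub>R x) i"
    by (intro mult_left_le) (simp_all add: post_nonneg)
  then show ?thesis by (simp add: add_increasing2)
next
  case False
  define z where "z = (bias \<theta> i - level \<theta> x) / \<sigma>\<^sup>2"
  have z: "z > 0" using False sigma by (simp add: z_def)
  have "(bias \<theta> i - level \<theta> x) / (4 * \<sigma>\<^sup>2) = z / 4"
    by (simp add: z_def)
  from post_le[OF h i, unfolded this]
  have "post (\<theta> + \<sigma> *\<^sub>R x) i * exp (b * z) \<le> exp (- \<kappa> * \<rho> i) * exp (- (z / 4)) * exp (b * z)"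
    by (rule mult_right_mono) simp
  also have "\<dots> = exp (- \<kappa> * \<rho> i) * exp (- (z / 4) + b * z)"
    by (simp only: mult.assoc exp_add)
  also have "\<dots> \<le> exp (- \<kappa> * \<rho> i)"
    using z mult_right_mono[OF b(2), of z] by (intro mult_left_le) simp_all
  also have "\<dots> \<le> post (\<theta> + \<sigma> *\<^sub>R x) i + exp (- \<kappa> * \<rho> i)"
    by (simp add: post_nonneg)
  finally show ?thesis unfolding z_def .
qed

lemma ddm_mix_le:
  assumes h: "minimiser (\<theta> + \<sigma> *\<^sub>R x) h"
  shows "ddm_mix \<I> L \<rho> \<kappa> \<sigma> PZ (\<theta> + \<sigma> *\<^sub>R x) B \<le> (1 + C) * (K * exp (b * (10 * X x - M)))"
proof -
  let ?y = "\<theta> + \<sigma> *\<^sub>R x"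
  define G where "G = K * exp (b * (10 * X x - M))"
  have G0: "G \<ge> 0" using K by (simp add: G_def)
  have sum: "((\<lambda>i. (post ?y i + exp (- \<kappa> * \<rho> i)) * G) has_sum ((1 + infsum (\<lambda>i. exp (- \<kappa> * \<rho> i)) \<I>) * G)) \<I>"
    by (intro has_sum_cmult_left has_sum_add post_has_sum has_sum_infsum summable_penalty)
  have le: "ddm_struct L \<sigma> PZ i ?y B * post ?y i \<le> (post ?y i + exp (- \<kappa> * \<rho> i)) * G"
    if i: "i \<in> \<I>" for i
  proof -
    have "ddm_struct L \<sigma> PZ i ?y B * post ?y i
        \<le> (exp (b * ((bias \<theta> i - level \<theta> x) / \<sigma>\<^sup>2)) * G) * post ?y i"
      unfolding G_def by (intro mult_right_mono ddm_struct_le i post_nonneg)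
    also have "\<dots> = (post ?y i * exp (b * ((bias \<theta> i - level \<theta> x) / \<sigma>\<^sup>2))) * G"
      by simp
    also have "\<dots> \<le> (post ?y i + exp (- \<kappa> * \<rho> i)) * G"
      by (intro mult_right_mono post_exp_le[OF h i] G0)
    finally show ?thesis .
  qed
  have "(\<lambda>i. ddm_struct L \<sigma> PZ i ?y B * post ?y i) summable_on \<I>"
    by (rule summable_on_comparison_test[OF has_sum_imp_summable[OF sum] le])
      (simp_all add: ddm_struct_def post_nonneg)
  then have "ddm_mix \<I> L \<rho> \<kappa> \<sigma> PZ ?y B \<le> (1 + infsum (\<lambda>i. exp (- \<kappa> * \<rho> i)) \<I>) * G"
    unfolding ddm_mix_def by (intro has_sum_mono[OF has_sum_infsum sum] le)
  also have "\<dots> \<le> (1 + C) * G"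
    using infsum_penalty_le G0 by (intro mult_right_mono) simp_all
  finally show ?thesis unfolding G_def .
qed

end

end

subsection \<open>Minimax bounds\<close>

text \<open>Translates events whose threshold contains the possibly infinite minimax rate
  \<open>R\<close> into real inequalities with the oracle rate \<open>r\<close>; the factor
  \<open>inverse c\<close> cancels \<open>c\<close>. Only monotonicity in \<open>R\<close> is used,
  so an infinite rate causes no case split.\<close>

lemma le_of_ennreal_threshold:
  assumes R: "ennreal (c * r) \<le> R"
    and le: "ennreal (m * inverse c) * R + ennreal s \<le> ennreal q"
    and "c > 0" "m \<ge> 0" "r \<ge> 0" "s \<ge> 0" "q \<ge> 0"
  shows "m * r + s \<le> q"
proof -
  have "ennreal (m * r + s) = ennreal (m * inverse c) * ennreal (c * r) + ennreal s"
    using assms by (simp add: ennreal_mult[symmetric] ennreal_plus[symmetric] del: ennreal_plus)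
  also have "\<dots> \<le> ennreal q"
    using R le by (meson add_right_mono mult_left_mono order_trans zero_le)
  finally show ?thesis using assms by (simp del: ennreal_plus)
qed

theorem corollary8p2:
  fixes \<Theta> :: "(real ^ 'n) set"
    and P :: "real ^ 'n \<Rightarrow> 'w measure"
    and \<xi> :: "'w \<Rightarrow> real ^ 'n"
    and \<sigma> :: real
    and \<I> :: "'i set"
    and L :: "'i \<Rightarrow> (real ^ 'n) set"
    and \<rho> d :: "'i \<Rightarrow> real"
    and \<alpha> \<nu> C\<nu> \<kappa> :: real
    and PZ :: "(real ^ 'n) measure"
    and Ihat :: "real ^ 'n \<Rightarrow> 'i"
    and pihat :: "real ^ 'n \<Rightarrow> (real ^ 'n) set \<Rightarrow> real"
    and thetahat :: "real ^ 'n \<Rightarrow> real ^ 'n"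
  assumes sigma: "\<sigma> > 0"
    and prob: "\<And>\<theta>. \<theta> \<in> \<Theta> \<Longrightarrow> prob_space (P \<theta>)"
    and noise: "\<And>\<theta>. \<theta> \<in> \<Theta> \<Longrightarrow> integrable (P \<theta>) \<xi> \<and> (LINT \<omega>|P \<theta>. \<xi> \<omega>) = 0"
    and structures: "countable \<I>" "\<I> \<noteq> {}"
    and subspaces: "\<And>i. i \<in> \<I> \<Longrightarrow> subspace (L i)"
    and rho_nonneg: "\<And>i. i \<in> \<I> \<Longrightarrow> \<rho> i \<ge> 0"
    and alpha: "0 < \<alpha>" "\<alpha> \<le> 1"
    and d_nonneg: "\<And>i. i \<in> \<I> \<Longrightarrow> d i \<ge> 0"
    and A1_finite: "\<And>i \<theta>. i \<in> \<I> \<Longrightarrow> \<theta> \<in> \<Theta> \<Longrightarrow>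
          integrable (P \<theta>) (\<lambda>\<omega>. exp (\<alpha> * (norm (orth_proj (L i) (\<xi> \<omega>)))\<^sup>2))"
    and A1: "\<And>i. i \<in> \<I> \<Longrightarrow>
          (SUP \<theta>\<in>\<Theta>. ereal (ln (LINT \<omega>|P \<theta>. exp (\<alpha> * (norm (orth_proj (L i) (\<xi> \<omega>)))\<^sup>2)))) \<le> ereal (d i)"
    and nu: "\<nu> > 0" "C\<nu> > 0"
    and A2_sum: "(\<lambda>i. exp (- \<nu> * \<rho> i)) summable_on \<I>" "(\<Sum>\<^sub>\<infinity>i\<in>\<I>. exp (- \<nu> * \<rho> i)) \<le> C\<nu>"
    and A2_dom: "\<And>i. i \<in> \<I> \<Longrightarrow> \<rho> i \<ge> d i"
    and kappa: "\<kappa> > (32 * \<nu> + 10 + \<alpha>) / (4 * \<alpha>)"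
    and Z_law: "prob_space PZ" "sets PZ = sets borel"
    and Z_mean: "integrable PZ (\<lambda>z. z)" "(LINT z|PZ. z) = 0"
    and Z_exp: "\<And>i. i \<in> \<I> \<Longrightarrow>
          integrable PZ (\<lambda>z. exp (\<alpha> * (norm (orth_proj (L i) z))\<^sup>2)) \<and>
          (LINT z|PZ. exp (\<alpha> * (norm (orth_proj (L i) z))\<^sup>2)) \<le> exp (d i)"
    and Ihat_measurable: "Ihat \<in> borel \<rightarrow>\<^sub>M count_space \<I>"
    and Ihat_argmax: "\<And>y. is_arg_max (struct_post \<I> L \<rho> \<kappa> \<sigma> y) (\<lambda>i. i \<in> \<I>) (Ihat y)"
    and hat: "(pihat, thetahat) \<in>
          {(ddm_mix \<I> L \<rho> \<kappa> \<sigma> PZ, est_mix \<I> L \<rho> \<kappa> \<sigma>), (ddm_sel L \<sigma> PZ Ihat, est_sel L Ihat)}"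
  shows "\<exists>M0 M1 M3 H0 H1 H3 m0 m1 m3 :: real.
    M0 > 0 \<and> M1 > 0 \<and> M3 > 0 \<and> H0 > 0 \<and> H1 > 0 \<and> H3 > 0 \<and> m0 > 0 \<and> m1 > 0 \<and> m3 > 0 \<and>
    (\<forall>(\<B> :: 'b set) (T :: 'b \<Rightarrow> (real ^ 'n) set) (c :: real).
      (\<forall>\<beta>\<in>\<B>. T \<beta> \<subseteq> \<Theta>) \<longrightarrow> c > 0 \<longrightarrow>
      (\<forall>\<beta>\<in>\<B>. \<forall>\<theta>\<in>T \<beta>. minimax_rate P \<xi> \<sigma> (T \<beta>) \<ge> ennreal (c * oracle_rate \<I> L \<rho> \<sigma> \<theta>)) \<longrightarrow>
      (\<forall>\<beta>\<in>\<B>. \<forall>M\<ge>0.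
        (SUP \<theta>\<in>T \<beta>. \<integral>\<^sup>+ \<omega>. ennreal (pihat (obs \<sigma> \<xi> \<theta> \<omega>)
            {v. ennreal ((norm (v - \<theta>))\<^sup>2)
                  \<ge> ennreal (M0 * inverse c) * minimax_rate P \<xi> \<sigma> (T \<beta>) + ennreal (M * \<sigma>\<^sup>2)}) \<partial>P \<theta>)
          \<le> ennreal (H0 * exp (- m0 * M)) \<and>
        (SUP \<theta>\<in>T \<beta>. emeasure (P \<theta>) {\<omega> \<in> space (P \<theta>).
            ennreal ((norm (thetahat (obs \<sigma> \<xi> \<theta> \<omega>) - \<theta>))\<^sup>2)
              \<ge> ennreal (M1 * inverse c) * minimax_rate P \<xi> \<sigma> (T \<beta>) + ennreal (M * \<sigma>\<^sup>2)})
          \<le> ennreal (H1 * exp (- m1 * M)) \<and>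
        (SUP \<theta>\<in>T \<beta>. emeasure (P \<theta>) {\<omega> \<in> space (P \<theta>).
            ennreal (sq_radius \<rho> \<sigma> Ihat (obs \<sigma> \<xi> \<theta> \<omega>))
              \<ge> ennreal (M3 * inverse c) * minimax_rate P \<xi> \<sigma> (T \<beta>) + ennreal ((M + 1) * \<sigma>\<^sup>2)})
          \<le> ennreal (H3 * exp (- m3 * M))))"
proof -
  \<comment> \<open>As \<open>\<alpha> \<le> 1\<close>, the threshold for \<open>\<kappa>\<close> is
    at least \<open>8 * \<nu> + 5 / 2\<close>.\<close>
  have kappa2: "\<kappa> \<ge> 2" and kappa_nu: "\<nu> \<le> \<kappa>"
  proof -
    have "(32 * \<nu> + 10 + \<alpha>) / (4 * \<alpha>) \<ge> (32 * \<nu> + 10 + \<alpha>) / 4"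
      using alpha nu by (intro divide_left_mono) simp_all
    then have "(32 * \<nu> + 10 + \<alpha>) / 4 < \<kappa>" using kappa by linarith
    then show "\<kappa> \<ge> 2" "\<nu> \<le> \<kappa>" using alpha nu by auto
  qed
  have penalty_le: "exp (- \<kappa> * \<rho> i) \<le> exp (- \<nu> * \<rho> i)" if "i \<in> \<I>" for i
    using kappa_nu rho_nonneg[OF that] by (simp add: mult_right_mono)
  have penalty_sum: "(\<lambda>i. exp (- \<kappa> * \<rho> i)) summable_on \<I>"
    by (rule summable_on_comparison_test[OF A2_sum(1) penalty_le]) simp_all
  interpret projection_structures \<I> L \<rho> \<sigma> \<kappa> C\<nu>
  proof
    show "(\<Sum>\<^sub>\<infinity>i\<in>\<I>. exp (- \<kappa> * \<rho> i)) \<le> C\<nu>"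
      using infsum_mono[OF penalty_sum A2_sum(1) penalty_le] A2_sum(2) by simp
  qed (use sigma kappa2 structures subspaces rho_nonneg nu penalty_sum in auto)
  obtain F a where F: "finite F" "F \<subseteq> \<I>" and a: "0 < a" "a \<le> 1"
    and exp_le: "\<And>x. exp (a * (norm (orth_proj (span (\<Union>i\<in>\<I>. L i)) x))\<^sup>2)
          \<le> 1 + (\<Sum>i\<in>F. exp (\<alpha> * (norm (orth_proj (L i) x))\<^sup>2))"
    by (rule exp_orth_proj_span_le[where \<I> = \<I> and L = L, OF subspaces alpha(1)]) (assumption | rule that)+
  define K where "K = 1 + (\<Sum>i\<in>F. exp (d i))"
  have K: "K > 0" by (simp add: K_def add_pos_nonneg sum_nonneg)
  \<comment> \<open>With this choice the factor \<open>exp (10 * b * X x)\<close> in the bounds for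
    the data dependent measures is \<open>exp (a * X x)\<close>, whose expectation is at most
    \<open>K\<close>.\<close>
  define b where "b = a / 10"
  have b: "0 < b" "b \<le> 1 / 4" and ab: "a = 10 * b"
    using a by (simp_all add: b_def)
  have mom: "(\<integral>\<^sup>+\<omega>. ennreal (exp (a * X (\<xi> \<omega>))) \<partial>P \<theta>) \<le> ennreal K" if \<theta>: "\<theta> \<in> \<Theta>" for \<theta>
    unfolding X_def K_def
  proof (rule nn_integral_exp_orth_proj_span_le[OF prob[OF \<theta>] _ F subspaces exp_le])
    show "\<xi> \<in> borel_measurable (P \<theta>)" using noise[OF \<theta>] by auto
    fix i assume i: "i \<in> \<I>"
    let ?I = "LINT \<omega>|P \<theta>. exp (\<alpha> * (norm (orth_proj (L i) (\<xi> \<omega>)))\<^sup>2)"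
    have "ereal (ln ?I) \<le> ereal (d i)"
      using A1[OF i] \<theta> by (meson SUP_upper order_trans)
    then have "?I \<le> exp (d i)"
      \<comment> \<open>The logarithm is inverted only for positive \<open>?I\<close>; otherwise the
        bound holds because \<open>exp\<close> is positive.\<close>
      by (cases "?I > 0") (simp_all add: ln_ge_iff[symmetric] ln_le_cancel_iff[symmetric] order_trans[OF _ less_imp_le[OF exp_gt_zero]] del: ln_le_cancel_iff)
    then show "(\<integral>\<^sup>+\<omega>. ennreal (exp (\<alpha> * (norm (orth_proj (L i) (\<xi> \<omega>)))\<^sup>2)) \<partial>P \<theta>) \<le> ennreal (exp (d i))"
      by (subst nn_integral_eq_integral[OF A1_finite[OF i \<theta>]]) (simp_all add: ennreal_leI)
  qed
  have momZ: "(\<integral>\<^sup>+z. ennreal (exp (2 * b * X z)) \<partial>PZ) \<le> ennreal K"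
  proof -
    have "(\<integral>\<^sup>+z. ennreal (exp (2 * b * X z)) \<partial>PZ) \<le> (\<integral>\<^sup>+z. ennreal (exp (a * X z)) \<partial>PZ)"
      unfolding ab using b(1)
      by (intro nn_integral_mono ennreal_leI) (simp add: X_nonneg mult_right_mono)
    also have "\<dots> \<le> ennreal K"
      unfolding X_def K_def
    proof (rule nn_integral_exp_orth_proj_span_le[OF Z_law(1) _ F subspaces exp_le])
      show "(\<lambda>z. z) \<in> borel_measurable PZ" using Z_mean by auto
      fix i assume i: "i \<in> \<I>"
      show "(\<integral>\<^sup>+z. ennreal (exp (\<alpha> * (norm (orth_proj (L i) z))\<^sup>2)) \<partial>PZ) \<le> ennreal (exp (d i))"
        using Z_exp[OF i] by (subst nn_integral_eq_integral) (simp_all add: ennreal_leI)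
    qed
    finally show ?thesis .
  qed
  have minim: "minimiser y (Ihat y)" for y
    by (rule is_arg_max_minimiser[OF Ihat_argmax])
  have pihat_le: "pihat (\<theta> + \<sigma> *\<^sub>R x) B \<le> (1 + C\<nu>) * (K * exp (b * (10 * X x - M)))"
    if "B \<subseteq> {v. 4 * \<kappa> * rate \<theta> + M * \<sigma>\<^sup>2 \<le> (norm (v - \<theta>))\<^sup>2}" for \<theta> x B M
    using hat ddm_mix_le[OF Z_law(2) b less_imp_le[OF K] momZ that minim]
      ddm_sel_le[where Ihat = Ihat, OF Z_law(2) b less_imp_le[OF K] momZ that minim] by auto
  have thetahat_le: "(norm (thetahat (\<theta> + \<sigma> *\<^sub>R x) - \<theta>))\<^sup>2 \<le> 4 * \<kappa> * rate \<theta> + 9 * \<sigma>\<^sup>2 * X x + 4 * \<sigma>\<^sup>2 * C\<nu>" for \<theta> x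
    using hat est_mix_loss_le[OF minim] est_sel_loss_le[where Ihat = Ihat, OF minim] by auto
  have X_meas: "(\<lambda>\<omega>. X (\<xi> \<omega>)) \<in> borel_measurable (P \<theta>)" if "\<theta> \<in> \<Theta>" for \<theta>
    using noise[OF that] by (auto intro: measurable_compose[OF _ measurable_X])
  \<comment> \<open>The three bounds for a single parameter set \<open>T\<close>. The constants
    involve neither \<open>T\<close> nor \<open>c\<close> nor \<open>M\<close>, as the order of the
    quantifiers demands.\<close>
  have concl0: "(SUP \<theta>\<in>T. \<integral>\<^sup>+ \<omega>. ennreal (pihat (obs \<sigma> \<xi> \<theta> \<omega>)
            {v. ennreal ((norm (v - \<theta>))\<^sup>2)
                  \<ge> ennreal (4 * \<kappa> * inverse c) * minimax_rate P \<xi> \<sigma> T + ennreal (M * \<sigma>\<^sup>2)}) \<partial>P \<theta>)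
          \<le> ennreal ((1 + C\<nu>) * K * K * exp (- b * M))" (is ?concl0)
    and concl1: "(SUP \<theta>\<in>T. emeasure (P \<theta>) {\<omega> \<in> space (P \<theta>).
            ennreal ((norm (thetahat (obs \<sigma> \<xi> \<theta> \<omega>) - \<theta>))\<^sup>2)
              \<ge> ennreal (4 * \<kappa> * inverse c) * minimax_rate P \<xi> \<sigma> T + ennreal (M * \<sigma>\<^sup>2)})
          \<le> ennreal (K * exp (4 * b * C\<nu>) * exp (- b * M))" (is ?concl1)
    and concl3: "(SUP \<theta>\<in>T. emeasure (P \<theta>) {\<omega> \<in> space (P \<theta>).
            ennreal (sq_radius \<rho> \<sigma> Ihat (obs \<sigma> \<xi> \<theta> \<omega>))
              \<ge> ennreal (1 * inverse c) * minimax_rate P \<xi> \<sigma> T + ennreal ((M + 1) * \<sigma>\<^sup>2)})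
          \<le> ennreal (K * exp (- b * M))" (is ?concl3)
    if T: "T \<subseteq> \<Theta>" and c: "c > 0" and M: "M \<ge> 0"
      and R: "\<And>\<theta>. \<theta> \<in> T \<Longrightarrow> ennreal (c * rate \<theta>) \<le> minimax_rate P \<xi> \<sigma> T"
    for T :: "(real ^ 'n) set" and c M :: real
  proof -
    show ?concl0
    proof (rule SUP_least)
      fix \<theta> assume \<theta>: "\<theta> \<in> T"
      let ?B = "{v. ennreal ((norm (v - \<theta>))\<^sup>2)
                  \<ge> ennreal (4 * \<kappa> * inverse c) * minimax_rate P \<xi> \<sigma> T + ennreal (M * \<sigma>\<^sup>2)}"
      have "?B \<subseteq> {v. 4 * \<kappa> * rate \<theta> + M * \<sigma>\<^sup>2 \<le> (norm (v - \<theta>))\<^sup>2}"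
        using le_of_ennreal_threshold[OF R[OF \<theta>] _ c, of "4 * \<kappa>"] kappa2 M rate_nonneg by auto
      then have "pihat (obs \<sigma> \<xi> \<theta> \<omega>) ?B \<le> ((1 + C\<nu>) * K * exp (- b * M)) * exp (a * X (\<xi> \<omega>))" for \<omega>
        using pihat_le[of ?B \<theta> M "\<xi> \<omega>"]
        by (simp add: obs_def ab exp_add[symmetric] algebra_simps exp_diff exp_minus field_simps)
      then have "(\<integral>\<^sup>+ \<omega>. ennreal (pihat (obs \<sigma> \<xi> \<theta> \<omega>) ?B) \<partial>P \<theta>)
        \<le> (\<integral>\<^sup>+ \<omega>. ennreal ((1 + C\<nu>) * K * exp (- b * M)) * ennreal (exp (a * X (\<xi> \<omega>))) \<partial>P \<theta>)"
        using K nu by (intro nn_integral_mono) (simp add: ennreal_mult[symmetric] ennreal_leI)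
      also have "\<dots> = ennreal ((1 + C\<nu>) * K * exp (- b * M)) * (\<integral>\<^sup>+ \<omega>. ennreal (exp (a * X (\<xi> \<omega>))) \<partial>P \<theta>)"
        using X_meas \<theta> T by (intro nn_integral_cmult) auto
      also have "\<dots> \<le> ennreal ((1 + C\<nu>) * K * exp (- b * M)) * ennreal K"
        using mom \<theta> T by (intro mult_left_mono) auto
      also have "\<dots> = ennreal ((1 + C\<nu>) * K * K * exp (- b * M))"
        using K nu by (simp add: ennreal_mult[symmetric] mult_ac)
      finally show "(\<integral>\<^sup>+ \<omega>. ennreal (pihat (obs \<sigma> \<xi> \<theta> \<omega>) ?B) \<partial>P \<theta>)
        \<le> ennreal ((1 + C\<nu>) * K * K * exp (- b * M))" .
    qed
    show ?concl1
    proof (rule SUP_least)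
      fix \<theta> assume \<theta>: "\<theta> \<in> T"
      let ?A = "{\<omega> \<in> space (P \<theta>). ennreal ((norm (thetahat (obs \<sigma> \<xi> \<theta> \<omega>) - \<theta>))\<^sup>2)
              \<ge> ennreal (4 * \<kappa> * inverse c) * minimax_rate P \<xi> \<sigma> T + ennreal (M * \<sigma>\<^sup>2)}"
      have "?A \<subseteq> {\<omega> \<in> space (P \<theta>). b * M - 4 * b * C\<nu> \<le> a * X (\<xi> \<omega>)}"
      proof clarify
        fix \<omega> assume "ennreal ((norm (thetahat (obs \<sigma> \<xi> \<theta> \<omega>) - \<theta>))\<^sup>2)
              \<ge> ennreal (4 * \<kappa> * inverse c) * minimax_rate P \<xi> \<sigma> T + ennreal (M * \<sigma>\<^sup>2)"
        then have "4 * \<kappa> * rate \<theta> + M * \<sigma>\<^sup>2 \<le> (norm (thetahat (obs \<sigma> \<xi> \<theta> \<omega>) - \<theta>))\<^sup>2"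
          using kappa2 M rate_nonneg by (intro le_of_ennreal_threshold[OF R[OF \<theta>] _ c]) auto
        also have "\<dots> \<le> 4 * \<kappa> * rate \<theta> + 9 * \<sigma>\<^sup>2 * X (\<xi> \<omega>) + 4 * \<sigma>\<^sup>2 * C\<nu>"
          unfolding obs_def by (rule thetahat_le)
        finally have "\<sigma>\<^sup>2 * M \<le> \<sigma>\<^sup>2 * (9 * X (\<xi> \<omega>) + 4 * C\<nu>)"
          by (simp add: algebra_simps)
        \<comment> \<open>Enlarging \<open>9\<close> to \<open>10\<close> makes \<open>b\<close>
          times the noise term equal to \<open>a * X (\<xi> \<omega>)\<close>; the constant
          \<open>4 * C\<nu>\<close> becomes the factor \<open>exp (4 * b * C\<nu>)\<close>.\<close>
        then have "M \<le> 10 * X (\<xi> \<omega>) + 4 * C\<nu>"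
          using sigma X_nonneg[of "\<xi> \<omega>"] by simp
        from mult_left_mono[OF this, of b] show "b * M - 4 * b * C\<nu> \<le> a * X (\<xi> \<omega>)"
          using b by (simp add: ab algebra_simps)
      qed
      then have "emeasure (P \<theta>) ?A \<le> ennreal (K * exp (- (b * M - 4 * b * C\<nu>)))"
        using \<theta> T by (intro emeasure_le_exp_moment[OF X_meas mom]) auto
      then show "emeasure (P \<theta>) ?A \<le> ennreal (K * exp (4 * b * C\<nu>) * exp (- b * M))"
        by (simp add: mult.assoc exp_add[symmetric])
    qed
    show ?concl3
    proof (rule SUP_least)
      fix \<theta> assume \<theta>: "\<theta> \<in> T"
      let ?A = "{\<omega> \<in> space (P \<theta>). ennreal (sq_radius \<rho> \<sigma> Ihat (obs \<sigma> \<xi> \<theta> \<omega>))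
              \<ge> ennreal (1 * inverse c) * minimax_rate P \<xi> \<sigma> T + ennreal ((M + 1) * \<sigma>\<^sup>2)}"
      have "?A \<subseteq> {\<omega> \<in> space (P \<theta>). b * M \<le> a * X (\<xi> \<omega>)}"
      proof clarify
        fix \<omega> assume A: "ennreal (sq_radius \<rho> \<sigma> Ihat (obs \<sigma> \<xi> \<theta> \<omega>))
              \<ge> ennreal (1 * inverse c) * minimax_rate P \<xi> \<sigma> T + ennreal ((M + 1) * \<sigma>\<^sup>2)"
        have "0 \<le> sq_radius \<rho> \<sigma> Ihat (obs \<sigma> \<xi> \<theta> \<omega>)"
          using minim rho_nonneg by (simp add: sq_radius_def minimiser_def)
        then have "1 * rate \<theta> + (M + 1) * \<sigma>\<^sup>2 \<le> sq_radius \<rho> \<sigma> Ihat (obs \<sigma> \<xi> \<theta> \<omega>)"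
          using M rate_nonneg by (intro le_of_ennreal_threshold[OF R[OF \<theta>] A c]) auto
        \<comment> \<open>The extra \<open>\<sigma>\<^sup>2\<close> in the radius is matched by
          \<open>M + 1\<close> in the threshold, and the oracle rate cancels because its coefficient
          is one on both sides.\<close>
        then have "\<sigma>\<^sup>2 * M \<le> \<sigma>\<^sup>2 * X (\<xi> \<omega>)"
          using minimiser_rho_le[OF minim, of \<theta> "\<xi> \<omega>"] by (simp add: sq_radius_def obs_def algebra_simps)
        then have "M \<le> 10 * X (\<xi> \<omega>)"
          using sigma X_nonneg[of "\<xi> \<omega>"] by simp
        from mult_left_mono[OF this, of b] show "b * M \<le> a * X (\<xi> \<omega>)"
          using b by (simp add: ab algebra_simps)
      qed
      then have "emeasure (P \<theta>) ?A \<le> ennreal (K * exp (- (b * M)))"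
        using \<theta> T by (intro emeasure_le_exp_moment[OF X_meas mom]) auto
      then show "emeasure (P \<theta>) ?A \<le> ennreal (K * exp (- b * M))"
        by simp
    qed
  qed
  show ?thesis
  proof (rule exI[of _ "4 * \<kappa>"], rule exI[of _ "4 * \<kappa>"], rule exI[of _ 1],
      rule exI[of _ "(1 + C\<nu>) * K * K"], rule exI[of _ "K * exp (4 * b * C\<nu>)"], rule exI[of _ K],
      rule exI[of _ b], rule exI[of _ b], rule exI[of _ b], intro conjI allI impI ballI)
  qed (use concl0 concl1 concl3 kappa2 K b nu in auto)
qed

end
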